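(* Let $x_a\in\mathbb{R}$ be fixed, let $L:[a,b]\times\mathbb{R}^2\to\mathbb{R}$ be differentiable, $\phi:[a,b]\times\mathbb{R}\to\mathbb{R}$ of class $C^1$, $g:[a,b]\times\mathbb{R}^2\to\mathbb{R}$ of class $C^1$ and $\psi:[a,b]\to\mathbb{R}$ differentiable. Suppose that $(x,T)$ gives a local minimum on $D$ for the functional $$\mathcal{J}(x,T)=\int_a^TL[x]_\gamma^{\alpha,\beta}(t)\,dt+\phi(T,x(T))$$ subject to the boundary condition $x(a)=x_a$ and the isoperimetric constraint $$\int_a^Tg[x]_\gamma^{\alpha,\beta}(t)\,dt=\psi(T).$$ If $(x,T)$ does not satisfy the Euler--Lagrange equations with respect to the isoperimetric constraint, that is, if one of the two following conditions is not verified, $$\partial_2g[x]_\gamma^{\alpha,\beta}(t)+D_{\overline\gamma,T}^{\beta(\cdot,\cdot),\alpha(\cdot,\cdot)}\partial_3g[x]_\gamma^{\alpha,\beta}(t)=0,\quad t\in[a,T],$$ or $$\gamma_2\left[{}_aD_t^{\beta(\cdot,\cdot)}\partial_3g[x]_\gamma^{\alpha,\beta}(t)-{}_TD_t^{\beta(\cdot,\cdot)}\partial_3g[x]_\gamma^{\alpha,\beta}(t)\right]=0,\quad t\in[T,b],$$ then there exists a constant $\lambda$ such that, if we define $F:[a,b]\times\mathbb{R}^2\to\mathbb{R}$ by $F=L-\lambda g$, $(x,T)$ satisfies the fractional Euler--Lagrange equations $$\partial_2F[x]_\gamma^{\alpha,\beta}(t)+D_{\overline\gamma,T}^{\beta(\cdot,\cdot),\alpha(\cdot,\cdot)}\partial_3F[x]_\gamma^{\alpha,\beta}(t)=0$$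 on the interval $[a,T]$ and $$\gamma_2\left({}_aD_t^{\beta(\cdot,\cdot)}\partial_3F[x]_\gamma^{\alpha,\beta}(t)-{}_TD_t^{\beta(\cdot,\cdot)}\partial_3F[x]_\gamma^{\alpha,\beta}(t)\right)=0$$ on the interval $[T,b]$. Moreover, $(x,T)$ satisfies the transversality conditions $$ \begin{cases} F[x]_\gamma^{\alpha,\beta}(T)+\partial_1\phi(T,x(T))+\partial_2\phi(T,x(T))x'(T)+\lambda\psi'(T)=0,\\ \left[\gamma_1\,{}_tI_T^{1-\alpha(\cdot,\cdot)}\partial_3F[x]_\gamma^{\alpha,\beta}(t)-\gamma_2\,{}_TI_t^{1-\beta(\cdot,\cdot)}\partial_3F[x]_\gamma^{\alpha,\beta}(t)\right]_{t=T}+\partial_2\phi(T,x(T))=0,\\ \gamma_2\left[{}_TI_t^{1-\beta(\cdot,\cdot)}\partial_3F[x]_\gamma^{\alpha,\beta}(t)-{}_aI_t^{1-\beta(\cdot,\cdot)}\partial_3F[x]_\gamma^{\alpha,\beta}(t)\right]_{t=b}=0. \end{cases} $$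
   Context: Let $a<b$ be reals, $\alpha,\beta:[a,b]^2\to(0,1)$ continuous functions, and $\gamma=(\gamma_1,\gamma_2)\in[0,1]^2$ with $\gamma_1,\gamma_2$ not both zero; $\overline\gamma=(\gamma_2,\gamma_1)$. For $c\in[a,b]$ and $\delta\in\{\alpha,\beta\}$ define the variable-order Riemann--Liouville integrals $${}_cI_t^{1-\delta(\cdot,\cdot)}f(t)=\int_c^t\frac{(t-\tau)^{-\delta(t,\tau)}}{\Gamma(1-\delta(t,\tau))}f(\tau)\,d\tau\ (t>c),\qquad {}_tI_c^{1-\delta(\cdot,\cdot)}f(t)=\int_t^c\frac{(\tau-t)^{-\delta(\tau,t)}}{\Gamma(1-\delta(\tau,t))}f(\tau)\,d\tau\ (t<c),$$ the Riemann--Liouville derivatives ${}_cD_t^{\delta(\cdot,\cdot)}f(t)=\frac{d}{dt}\,{}_cI_t^{1-\delta(\cdot,\cdot)}f(t)$ and ${}_tD_c^{\delta(\cdot,\cdot)}f(t)=-\frac{d}{dt}\,{}_tI_c^{1-\delta(\cdot,\cdot)}f(t)$, and the Caputo derivatives ${}_a^CD_t^{\alpha(\cdot,\cdot)}x(t)={}_aI_t^{1-\alpha(\cdot,\cdot)}x'(t)$ and ${}_t^CD_b^{\beta(\cdot,\cdot)}x(t)=-{}_tI_b^{1-\beta(\cdot,\cdot)}x'(t)$. The combined Caputo fractional derivative is ${}^CD_\gamma^{\alpha(\cdot,\cdot),\beta(\cdot,\cdot)}x(t)=\gamma_1\,{}_a^CD_t^{\alpha(\cdot,\cdot)}x(t)+\gamma_2\,{}_t^CD_b^{\beta(\cdot,\cdot)}x(t)$;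 for $c\in(a,b]$ the dual derivative is $D_{\overline\gamma,c}^{\beta(\cdot,\cdot),\alpha(\cdot,\cdot)}=\gamma_2\,{}_aD_t^{\beta(\cdot,\cdot)}+\gamma_1\,{}_tD_c^{\alpha(\cdot,\cdot)}$. Notation: $[x]_\gamma^{\alpha,\beta}(t)=\left(t,x(t),{}^CD_\gamma^{\alpha(\cdot,\cdot),\beta(\cdot,\cdot)}x(t)\right)$; $F[x]_\gamma^{\alpha,\beta}(t)$ means $F$ evaluated at this vector; $\partial_iF$ is the partial derivative with respect to the $i$th argument. $D=\{(x,t)\in C^1([a,b])\times[a,b]:\ {}^CD_\gamma^{\alpha(\cdot,\cdot),\beta(\cdot,\cdot)}x\in C([a,b])\}$, with norm $\|(x,t)\|=\max_{[a,b]}|x|+\max_{[a,b]}|{}^CD_\gamma^{\alpha(\cdot,\cdot),\beta(\cdot,\cdot)}x|+|t|$; local minimum is with respect to this norm among admissible pairs of $D$. $T$ and $x(T)$ are free.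
   Formalization: The formal theorem assumes in addition that ∂₂L and ∂₃L are continuous (for L merely differentiable the claim is false) and that a<T<b (for T=b the first transversality condition can fail; for T=a the dual derivative is undefined). *)

theory Defs
  imports "HOL-Analysis.Analysis"
begin

text \<open>
  Derivatives on \<open>[a,b]\<close> are taken within the interval (one-sided at the end points), so
  that the values of a function outside \<open>[a,b]\<close> play no role.
\<close>

definition derivI :: "real \<Rightarrow> real \<Rightarrow> (real \<Rightarrow> real) \<Rightarrow> real \<Rightarrow> real" where
  "derivI a b f t = vector_derivative f (at t within {a..b})"

definition C1_on ::
  "('a::real_normed_vector \<Rightarrow> 'b::real_normed_vector) \<Rightarrow> 'a set \<Rightarrow> bool" where
  "C1_on f S \<longleftrightarrow>
    (\<exists>f'. continuous_on S f' \<and> (\<forall>p\<in>S. (f has_derivative blinfun_apply (f' p)) (at p within S)))"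

definition pd2 :: "(real \<times> real \<times> real \<Rightarrow> real) \<Rightarrow> real \<times> real \<times> real \<Rightarrow> real" where
  "pd2 F = (\<lambda>(t, u, v). deriv (\<lambda>w. F (t, w, v)) u)"

definition pd3 :: "(real \<times> real \<times> real \<Rightarrow> real) \<Rightarrow> real \<times> real \<times> real \<Rightarrow> real" where
  "pd3 F = (\<lambda>(t, u, v). deriv (\<lambda>w. F (t, u, w)) v)"

definition pd1_phi :: "real \<Rightarrow> real \<Rightarrow> (real \<times> real \<Rightarrow> real) \<Rightarrow> real \<times> real \<Rightarrow> real" where
  "pd1_phi a b \<phi> = (\<lambda>(t, u). derivI a b (\<lambda>s. \<phi> (s, u)) t)"

definition pd2_phi :: "(real \<times> real \<Rightarrow> real) \<Rightarrow> real \<times> real \<Rightarrow> real" where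
  "pd2_phi \<phi> = (\<lambda>(t, u). deriv (\<lambda>w. \<phi> (t, w)) u)"

text \<open>
  The Riemann--Liouville integrals of order \<open>1 - \<delta>(\<cdot>,\<cdot>)\<close>. At \<open>t = c\<close> they are integrals over a
  single point, hence \<open>0\<close>, which for bounded \<open>f\<close> is also their limit as \<open>t\<close> tends to \<open>c\<close>.
\<close>

definition RL_int_left ::
  "real \<Rightarrow> (real \<Rightarrow> real \<Rightarrow> real) \<Rightarrow> (real \<Rightarrow> real) \<Rightarrow> real \<Rightarrow> real" where
  "RL_int_left c \<delta> f t =
    integral {c..t} (\<lambda>\<tau>. (t - \<tau>) powr (- \<delta> t \<tau>) / Gamma (1 - \<delta> t \<tau>) * f \<tau>)"

definition RL_int_right ::
  "real \<Rightarrow> (real \<Rightarrow> real \<Rightarrow> real) \<Rightarrow> (real \<Rightarrow> real) \<Rightarrow> real \<Rightarrow> real" where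
  "RL_int_right c \<delta> f t =
    integral {t..c} (\<lambda>\<tau>. (\<tau> - t) powr (- \<delta> \<tau> t) / Gamma (1 - \<delta> \<tau> t) * f \<tau>)"

text \<open>
  The Riemann--Liouville derivatives, as relations ``the derivative exists at \<open>t\<close> (relative to
  the interval \<open>S\<close> under consideration) and equals \<open>d\<close>''.
\<close>

definition has_RL_deriv_left ::
  "real \<Rightarrow> (real \<Rightarrow> real \<Rightarrow> real) \<Rightarrow> (real \<Rightarrow> real) \<Rightarrow> real \<Rightarrow> real \<Rightarrow> real set \<Rightarrow> bool" where
  "has_RL_deriv_left c \<delta> f d t S \<longleftrightarrow> (RL_int_left c \<delta> f has_real_derivative d) (at t within S)"

definition has_RL_deriv_right ::
  "real \<Rightarrow> (real \<Rightarrow> real \<Rightarrow> real) \<Rightarrow> (real \<Rightarrow> real) \<Rightarrow> real \<Rightarrow> real \<Rightarrow> real set \<Rightarrow> bool" where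
  "has_RL_deriv_right c \<delta> f d t S \<longleftrightarrow>
    ((\<lambda>s. - RL_int_right c \<delta> f s) has_real_derivative d) (at t within S)"

text \<open>
  The dual derivative \<open>\<eta>\<^sub>1 \<^sub>aD\<^sub>t\<^sup>\<beta> + \<eta>\<^sub>2 \<^sub>tD\<^sub>c\<^sup>\<alpha>\<close>, where \<open>\<eta> = (\<eta>\<^sub>1, \<eta>\<^sub>2)\<close> is the swapped \<open>\<gamma>\<close>. As an
  operator it is \<open>d/dt\<close> applied to \<open>\<eta>\<^sub>1 \<^sub>aI\<^sub>t\<^sup>1\<^sup>-\<^sup>\<beta> - \<eta>\<^sub>2 \<^sub>tI\<^sub>c\<^sup>1\<^sup>-\<^sup>\<alpha>\<close>. The derivative is taken of the
  combination because the Euler--Lagrange equation is required on the closed interval \<open>[a,c]\<close>,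
  where the two summands need not be differentiable one by one: already for constant order,
  \<open>\<^sub>aI\<^sub>t\<^sup>1\<^sup>-\<^sup>\<beta> f\<close> has an infinite slope at \<open>t = a\<close> unless \<open>f a = 0\<close>. Whenever both
  Riemann--Liouville derivatives exist, the value is their linear combination:
  see \<open>has_dual_deriv_iff\<close> below.
\<close>

definition has_dual_deriv ::
  "real \<Rightarrow> real \<Rightarrow> real \<Rightarrow> real \<Rightarrow> (real \<Rightarrow> real \<Rightarrow> real) \<Rightarrow> (real \<Rightarrow> real \<Rightarrow> real) \<Rightarrow>
   (real \<Rightarrow> real) \<Rightarrow> real \<Rightarrow> real \<Rightarrow> bool" where
  "has_dual_deriv \<eta>\<^sub>1 \<eta>\<^sub>2 a c \<beta> \<alpha> f d t \<longleftrightarrow>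
    ((\<lambda>s. \<eta>\<^sub>1 * RL_int_left a \<beta> f s + \<eta>\<^sub>2 * (- RL_int_right c \<alpha> f s)) has_real_derivative d)
      (at t within {a..c})"

text \<open>
  \<open>\<eta> (\<^sub>aD\<^sub>t\<^sup>\<beta> f - \<^sub>cD\<^sub>t\<^sup>\<beta> f)\<close> on \<open>[c,b]\<close>, with the same convention.
\<close>

definition has_diff_deriv ::
  "real \<Rightarrow> real \<Rightarrow> real \<Rightarrow> real \<Rightarrow> (real \<Rightarrow> real \<Rightarrow> real) \<Rightarrow>
   (real \<Rightarrow> real) \<Rightarrow> real \<Rightarrow> real \<Rightarrow> bool" where
  "has_diff_deriv \<eta> a c b \<beta> f d t \<longleftrightarrow>
    ((\<lambda>s. \<eta> * (RL_int_left a \<beta> f s - RL_int_left c \<beta> f s)) has_real_derivative d)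
      (at t within {c..b})"

lemma has_real_derivative_unique_Icc:
  fixes f :: "real \<Rightarrow> real"
  assumes "a < c" "t \<in> {a..c}"
    and "(f has_real_derivative d) (at t within {a..c})"
    and "(f has_real_derivative e) (at t within {a..c})"
  shows "d = e"
  using vector_derivative_unique_within[of t "{a..c}" f d e] assms
  by (auto simp: has_real_derivative_iff_has_vector_derivative
      trivial_limit_within islimpt_Icc)

lemma has_dual_deriv_iff:
  assumes "a < c" "t \<in> {a..c}"
    and "has_RL_deriv_left a \<beta> f p t {a..c}" "has_RL_deriv_right c \<alpha> f q t {a..c}"
  shows "has_dual_deriv \<eta>\<^sub>1 \<eta>\<^sub>2 a c \<beta> \<alpha> f d t \<longleftrightarrow> d = \<eta>\<^sub>1 * p + \<eta>\<^sub>2 * q"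
proof -
  have "has_dual_deriv \<eta>\<^sub>1 \<eta>\<^sub>2 a c \<beta> \<alpha> f (\<eta>\<^sub>1 * p + \<eta>\<^sub>2 * q) t"
    using assms(3,4)
    unfolding has_dual_deriv_def has_RL_deriv_left_def has_RL_deriv_right_def
    by (intro DERIV_add DERIV_cmult)
  then show ?thesis
    using has_real_derivative_unique_Icc[OF assms(1,2)] unfolding has_dual_deriv_def by blast
qed

lemma has_diff_deriv_iff:
  assumes "c < b" "t \<in> {c..b}"
    and "has_RL_deriv_left a \<beta> f p t {c..b}" "has_RL_deriv_left c \<beta> f q t {c..b}"
  shows "has_diff_deriv \<eta> a c b \<beta> f d t \<longleftrightarrow> d = \<eta> * (p - q)"
proof -
  have "has_diff_deriv \<eta> a c b \<beta> f (\<eta> * (p - q)) t"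
    using assms(3,4)
    unfolding has_diff_deriv_def has_RL_deriv_left_def
    by (intro DERIV_diff DERIV_cmult)
  then show ?thesis
    using has_real_derivative_unique_Icc[OF assms(1,2)] unfolding has_diff_deriv_def by blast
qed

definition caputo_left ::
  "real \<Rightarrow> real \<Rightarrow> (real \<Rightarrow> real \<Rightarrow> real) \<Rightarrow> (real \<Rightarrow> real) \<Rightarrow> real \<Rightarrow> real" where
  "caputo_left a b \<alpha> x = RL_int_left a \<alpha> (derivI a b x)"

definition caputo_right ::
  "real \<Rightarrow> real \<Rightarrow> (real \<Rightarrow> real \<Rightarrow> real) \<Rightarrow> (real \<Rightarrow> real) \<Rightarrow> real \<Rightarrow> real" where
  "caputo_right a b \<beta> x t = - RL_int_right b \<beta> (derivI a b x) t"

definition comb_caputo ::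
  "real \<Rightarrow> real \<Rightarrow> (real \<Rightarrow> real \<Rightarrow> real) \<Rightarrow> (real \<Rightarrow> real \<Rightarrow> real) \<Rightarrow> real \<Rightarrow> real \<Rightarrow>
   (real \<Rightarrow> real) \<Rightarrow> real \<Rightarrow> real" where
  "comb_caputo a b \<alpha> \<beta> \<gamma>\<^sub>1 \<gamma>\<^sub>2 x t = \<gamma>\<^sub>1 * caputo_left a b \<alpha> x t + \<gamma>\<^sub>2 * caputo_right a b \<beta> x t"

definition bracket ::
  "real \<Rightarrow> real \<Rightarrow> (real \<Rightarrow> real \<Rightarrow> real) \<Rightarrow> (real \<Rightarrow> real \<Rightarrow> real) \<Rightarrow> real \<Rightarrow> real \<Rightarrow>
   (real \<Rightarrow> real) \<Rightarrow> real \<Rightarrow> real \<times> real \<times> real" where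
  "bracket a b \<alpha> \<beta> \<gamma>\<^sub>1 \<gamma>\<^sub>2 x t = (t, x t, comb_caputo a b \<alpha> \<beta> \<gamma>\<^sub>1 \<gamma>\<^sub>2 x t)"

definition dom_D ::
  "real \<Rightarrow> real \<Rightarrow> (real \<Rightarrow> real \<Rightarrow> real) \<Rightarrow> (real \<Rightarrow> real \<Rightarrow> real) \<Rightarrow> real \<Rightarrow> real \<Rightarrow>
   ((real \<Rightarrow> real) \<times> real) set" where
  "dom_D a b \<alpha> \<beta> \<gamma>\<^sub>1 \<gamma>\<^sub>2 =
    {(x, t). C1_on x {a..b} \<and> t \<in> {a..b} \<and> continuous_on {a..b} (comb_caputo a b \<alpha> \<beta> \<gamma>\<^sub>1 \<gamma>\<^sub>2 x)}"

definition norm_D ::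
  "real \<Rightarrow> real \<Rightarrow> (real \<Rightarrow> real \<Rightarrow> real) \<Rightarrow> (real \<Rightarrow> real \<Rightarrow> real) \<Rightarrow> real \<Rightarrow> real \<Rightarrow>
   (real \<Rightarrow> real) \<Rightarrow> real \<Rightarrow> real" where
  "norm_D a b \<alpha> \<beta> \<gamma>\<^sub>1 \<gamma>\<^sub>2 x t =
    (SUP s\<in>{a..b}. \<bar>x s\<bar>) + (SUP s\<in>{a..b}. \<bar>comb_caputo a b \<alpha> \<beta> \<gamma>\<^sub>1 \<gamma>\<^sub>2 x s\<bar>) + \<bar>t\<bar>"

definition cost ::
  "real \<Rightarrow> real \<Rightarrow> (real \<Rightarrow> real \<Rightarrow> real) \<Rightarrow> (real \<Rightarrow> real \<Rightarrow> real) \<Rightarrow> real \<Rightarrow> real \<Rightarrow>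
   (real \<times> real \<times> real \<Rightarrow> real) \<Rightarrow> (real \<times> real \<Rightarrow> real) \<Rightarrow> (real \<Rightarrow> real) \<Rightarrow> real \<Rightarrow> real" where
  "cost a b \<alpha> \<beta> \<gamma>\<^sub>1 \<gamma>\<^sub>2 L \<phi> x T =
    integral {a..T} (\<lambda>t. L (bracket a b \<alpha> \<beta> \<gamma>\<^sub>1 \<gamma>\<^sub>2 x t)) + \<phi> (T, x T)"

definition admissible ::
  "real \<Rightarrow> real \<Rightarrow> (real \<Rightarrow> real \<Rightarrow> real) \<Rightarrow> (real \<Rightarrow> real \<Rightarrow> real) \<Rightarrow> real \<Rightarrow> real \<Rightarrow>
   (real \<times> real \<times> real \<Rightarrow> real) \<Rightarrow> (real \<Rightarrow> real) \<Rightarrow> real \<Rightarrow> ((real \<Rightarrow> real) \<times> real) set" where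
  "admissible a b \<alpha> \<beta> \<gamma>\<^sub>1 \<gamma>\<^sub>2 g \<psi> x\<^sub>a =
    {(x, T) \<in> dom_D a b \<alpha> \<beta> \<gamma>\<^sub>1 \<gamma>\<^sub>2.
       x a = x\<^sub>a \<and> integral {a..T} (\<lambda>t. g (bracket a b \<alpha> \<beta> \<gamma>\<^sub>1 \<gamma>\<^sub>2 x t)) = \<psi> T}"

definition local_minimum ::
  "real \<Rightarrow> real \<Rightarrow> (real \<Rightarrow> real \<Rightarrow> real) \<Rightarrow> (real \<Rightarrow> real \<Rightarrow> real) \<Rightarrow> real \<Rightarrow> real \<Rightarrow>
   ((real \<Rightarrow> real) \<Rightarrow> real \<Rightarrow> real) \<Rightarrow> ((real \<Rightarrow> real) \<times> real) set \<Rightarrow> (real \<Rightarrow> real) \<Rightarrow> real \<Rightarrow> bool"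
  where
  "local_minimum a b \<alpha> \<beta> \<gamma>\<^sub>1 \<gamma>\<^sub>2 J A x T \<longleftrightarrow>
    (x, T) \<in> A \<and>
    (\<exists>\<epsilon>>0. \<forall>(y, S)\<in>A. norm_D a b \<alpha> \<beta> \<gamma>\<^sub>1 \<gamma>\<^sub>2 (\<lambda>s. y s - x s) (S - T) < \<epsilon> \<longrightarrow> J x T \<le> J y S)"

definition EL_before ::
  "real \<Rightarrow> real \<Rightarrow> (real \<Rightarrow> real \<Rightarrow> real) \<Rightarrow> (real \<Rightarrow> real \<Rightarrow> real) \<Rightarrow> real \<Rightarrow> real \<Rightarrow>
   (real \<times> real \<times> real \<Rightarrow> real) \<Rightarrow> (real \<Rightarrow> real) \<Rightarrow> real \<Rightarrow> bool" where
  "EL_before a b \<alpha> \<beta> \<gamma>\<^sub>1 \<gamma>\<^sub>2 F x T \<longleftrightarrow>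
    (\<forall>t\<in>{a..T}. \<exists>d.
       has_dual_deriv \<gamma>\<^sub>2 \<gamma>\<^sub>1 a T \<beta> \<alpha> (\<lambda>s. pd3 F (bracket a b \<alpha> \<beta> \<gamma>\<^sub>1 \<gamma>\<^sub>2 x s)) d t \<and>
       pd2 F (bracket a b \<alpha> \<beta> \<gamma>\<^sub>1 \<gamma>\<^sub>2 x t) + d = 0)"

definition EL_after ::
  "real \<Rightarrow> real \<Rightarrow> (real \<Rightarrow> real \<Rightarrow> real) \<Rightarrow> (real \<Rightarrow> real \<Rightarrow> real) \<Rightarrow> real \<Rightarrow> real \<Rightarrow>
   (real \<times> real \<times> real \<Rightarrow> real) \<Rightarrow> (real \<Rightarrow> real) \<Rightarrow> real \<Rightarrow> bool" where
  "EL_after a b \<alpha> \<beta> \<gamma>\<^sub>1 \<gamma>\<^sub>2 F x T \<longleftrightarrow>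
    (\<forall>t\<in>{T..b}.
       has_diff_deriv \<gamma>\<^sub>2 a T b \<beta> (\<lambda>s. pd3 F (bracket a b \<alpha> \<beta> \<gamma>\<^sub>1 \<gamma>\<^sub>2 x s)) 0 t)"

end

theory Submission
  imports Defs
begin

text \<open>
  Perturb \<open>x\<close> by \<open>h t = integral {a..t} u\<close> with \<open>u\<close> continuous, and \<open>T\<close> by a multiple of \<open>\<Delta>\<close>.
  Exchanging the order of integration moves the fractional operators from \<open>u\<close> to \<open>\<partial>\<^sub>3F\<close>, so that
  the first variation of the integral becomes \<open>\<integral> u W\<^sub>1\<close> over \<open>[a,T]\<close> plus \<open>\<integral> u W\<^sub>2\<close> over \<open>[T,b]\<close>
  with continuous \<open>W\<^sub>1\<close>, \<open>W\<^sub>2\<close>. As \<open>u\<close> is arbitrary, a vanishing first variation forces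
  \<open>W\<^sub>1 = W\<^sub>2 = 0\<close>; differentiating gives the Euler--Lagrange equations, and the values at \<open>T\<close> and
  \<open>b\<close> give transversality. If the first variation of the constraint is not identically zero, it
  is nonzero at some \<open>v\<close>, and the family \<open>x + e\<^sub>1 h\<^sub>u + e\<^sub>2 h\<^sub>v\<close> with end time \<open>T + e\<^sub>1 \<Delta>\<close> yields the
  multiplier. Since \<open>\<psi>\<close> is only differentiable, the constraint is solved for \<open>e\<^sub>2\<close> by the
  intermediate value theorem rather than by the implicit function theorem.
\<close>

section \<open>Weakly singular kernels\<close>

text \<open>The errors \<open>E n * s x\<close> tend to \<open>0\<close> at each point, so
  \<open>f\<close> is a pointwise limit of continuous functions with an integrable majorant and
  dominated convergence applies. The weight \<open>s\<close> may be unbounded, which is what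
  singular kernels require.\<close>

lemma integrable_limit_bound:
  fixes f s :: "real \<Rightarrow> real"
  assumes F: "\<And>n. continuous_on {c..d} (F n)"
    and s: "s integrable_on {c..d}" "\<And>x. x \<in> {c..d} \<Longrightarrow> 0 \<le> s x"
    and E: "E \<longlonglongrightarrow> 0"
    and le: "\<And>n x. x \<in> {c..d} \<Longrightarrow> \<bar>f x - F n x\<bar> \<le> E n * s x"
  shows "f integrable_on {c..d}"
    and "\<bar>integral {c..d} f - integral {c..d} (F n)\<bar> \<le> E n * integral {c..d} s"
proof -
  obtain M where M: "\<And>n. \<bar>E n\<bar> \<le> M"
    using convergent_imp_Bseq[OF convergentI[OF E]] by (auto simp: Bseq_def)
  obtain B where B: "\<And>x. x \<in> {c..d} \<Longrightarrow> \<bar>F 0 x\<bar> \<le> B"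
    using compact_imp_bounded[OF compact_continuous_image[OF F[of 0] compact_Icc]]
    by (auto simp: bounded_iff) (metis atLeastAtMost_iff)
  show f: "f integrable_on {c..d}"
  proof (rule dominated_convergence(1))
    show "F n integrable_on {c..d}" for n
      using F by (rule integrable_continuous_interval)
    \<comment> \<open>The majorant comes from comparing \<open>F n\<close> with \<open>f\<close> and
      then \<open>f\<close> with \<open>F 0\<close>: each comparison costs at most
      \<open>M * s x\<close>, and \<open>F 0\<close> is bounded by \<open>B\<close>.\<close>
    show "(\<lambda>x. B + 2 * M * s x) integrable_on {c..d}"
      by (intro integrable_add integrable_const_ivl integrable_on_mult_right s)
    show "norm (F n x) \<le> B + 2 * M * s x" if x: "x \<in> {c..d}" for n x
    proof -
      have "E k * s x \<le> M * s x" for k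
        using M[of k] s(2)[OF x] by (intro mult_right_mono) auto
      from this[of 0] this[of n] show ?thesis
        using B[OF x] le[OF x, of 0] le[OF x, of n] by simp
    qed
    show "(\<lambda>n. F n x) \<longlonglongrightarrow> f x" if x: "x \<in> {c..d}" for x
    proof -
      have "(\<lambda>n. f x - F n x) \<longlonglongrightarrow> 0"
      proof (rule Lim_null_comparison)
        show "\<forall>\<^sub>F n in sequentially. norm (f x - F n x) \<le> E n * s x"
          using le[OF x] by simp
        show "(\<lambda>n. E n * s x) \<longlonglongrightarrow> 0"
          using tendsto_mult_right[OF E] by simp
      qed
      then show ?thesis
        using tendsto_diff[OF tendsto_const[of "f x"]] by fastforce
    qed
  qed
  have Fi: "F n integrable_on {c..d}"
    using F by (rule integrable_continuous_interval)
  have "norm (integral {c..d} (\<lambda>x. f x - F n x)) \<le> integral {c..d} (\<lambda>x. E n * s x)"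
    using le by (intro integral_norm_bound_integral integrable_diff f Fi integrable_on_mult_right s) simp
  then show "\<bar>integral {c..d} f - integral {c..d} (F n)\<bar> \<le> E n * integral {c..d} s"
    by (simp add: Henstock_Kurzweil_Integration.integral_diff[OF f Fi])
qed

text \<open>Reflection and translation carry the integral of \<open>u powr (- q)\<close> from
  \<open>0\<close> to either end of the interval. Both forms are needed, since the kernel is
  integrated in each of its two arguments.\<close>

lemma has_integral_powr_diff:
  fixes q c t :: real
  assumes "q < 1" "c \<le> t"
  shows "((\<lambda>s. (t - s) powr (- q)) has_integral ((t - c) powr (1 - q) / (1 - q))) {c..t}"
    and "((\<lambda>s. (s - c) powr (- q)) has_integral ((t - c) powr (1 - q) / (1 - q))) {c..t}"
proof -
  have *: "((\<lambda>u. u powr (- q)) has_integral ((t - c) powr (1 - q) / (1 - q))) (cbox 0 (t - c))"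
    using has_integral_powr_from_0[of "- q" "t - c"] assms by (simp add: add.commute)
  have "(\<lambda>x. - (1 * x) + t) ` {0..t - c} = {c..t}"
  proof
    show "{c..t} \<subseteq> (\<lambda>x. - (1 * x) + t) ` {0..t - c}"
    proof
      fix s assume "s \<in> {c..t}"
      then show "s \<in> (\<lambda>x. - (1 * x) + t) ` {0..t - c}"
        by (intro image_eqI[of _ _ "t - s"]) auto
    qed
  qed auto
  then show "((\<lambda>s. (t - s) powr (- q)) has_integral ((t - c) powr (1 - q) / (1 - q))) {c..t}"
    using has_integral_affinity[OF *, of "-1" t] by simp
  have "(\<lambda>x. x + c) ` {0..t - c} = {c..t}"
    by simp
  then show "((\<lambda>s. (s - c) powr (- q)) has_integral ((t - c) powr (1 - q) / (1 - q))) {c..t}"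
    using has_integral_affinity[OF *, of 1 "- c"] by simp
qed

lemma integral_subset_zero:
  fixes f :: "'a::euclidean_space \<Rightarrow> real"
  assumes "S \<subseteq> T" "\<And>x. x \<in> T - S \<Longrightarrow> f x = 0"
  shows "integral T f = integral S f"
proof -
  have "(\<lambda>x. if x \<in> T then f x else 0) = (\<lambda>x. if x \<in> S then f x else 0)"
    using assms by (intro ext) auto
  then show ?thesis
    by (metis integral_restrict_UNIV)
qed

text \<open>
  The kernel is the limit of continuous kernels, uniformly in the norm weighted by the integrable
  singularity. This reduces continuity of the integrals and the exchange of integrals to the
  continuous case.
\<close>

definition weakly_singular :: "real \<Rightarrow> real \<Rightarrow> (real \<Rightarrow> real \<Rightarrow> real) \<Rightarrow> bool" where
  "weakly_singular a b w \<longleftrightarrow>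
    (\<exists>q<1. \<exists>W E. (\<forall>n. continuous_on ({a..b} \<times> {a..b}) (\<lambda>(t, s). W n t s)) \<and>
      (\<forall>n t s. t \<le> s \<longrightarrow> W n t s = 0) \<and> E \<longlonglongrightarrow> (0::real) \<and>
      (\<forall>n t s. a \<le> s \<longrightarrow> s \<le> t \<longrightarrow> t \<le> b \<longrightarrow>
        \<bar>w t s - W (n::nat) t s\<bar> \<le> E n * (t - s) powr (- q)))"

lemma weakly_singular_subset:
  assumes "weakly_singular a b w" "a \<le> c" "d \<le> b"
  shows "weakly_singular c d w"
proof -
  have sub: "{c..d} \<times> {c..d} \<subseteq> {a..b} \<times> {a..b}"
    using assms by auto
  from assms(1) obtain q W E where *: "q < 1"
    "\<And>n. continuous_on ({a..b} \<times> {a..b}) (\<lambda>(t, s). W n t s)"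
    "\<And>n t s. t \<le> s \<Longrightarrow> W n t s = 0" "E \<longlonglongrightarrow> (0::real)"
    "\<And>n t s. a \<le> s \<Longrightarrow> s \<le> t \<Longrightarrow> t \<le> b \<Longrightarrow> \<bar>w t s - W (n::nat) t s\<bar> \<le> E n * (t - s) powr (- q)"
    unfolding weakly_singular_def by metis
  then show ?thesis
    using assms continuous_on_subset[OF *(2) sub]
    unfolding weakly_singular_def by (intro exI[of _ q] conjI exI[of _ W] exI[of _ E]) auto
qed

text \<open>Replacing \<open>w\<close> by \<open>W n\<close> changes either integral by at most
  \<open>\<bar>E n\<bar> * B * D\<close>, uniformly in the free variable. Integrability, continuity
  and the exchange of integrals therefore pass from the continuous kernels to
  \<open>w\<close>.\<close>

lemma
  fixes w :: "real \<Rightarrow> real \<Rightarrow> real"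
  assumes w: "weakly_singular a b w" and f: "continuous_on {a..b} f"
  shows weakly_singular_integrable_left:
      "\<And>t. t \<in> {a..b} \<Longrightarrow> (\<lambda>s. w t s * f s) integrable_on {a..t}"
    and weakly_singular_integrable_right:
      "\<And>s. s \<in> {a..b} \<Longrightarrow> (\<lambda>t. w t s * f t) integrable_on {s..b}"
    and weakly_singular_continuous_left:
      "continuous_on {a..b} (\<lambda>t. integral {a..t} (\<lambda>s. w t s * f s))"
    and weakly_singular_continuous_right:
      "continuous_on {a..b} (\<lambda>s. integral {s..b} (\<lambda>t. w t s * f t))"
    and weakly_singular_swap:
      "\<And>u. continuous_on {a..b} u \<Longrightarrow>
        integral {a..b} (\<lambda>t. u t * integral {a..t} (\<lambda>s. w t s * f s)) =
        integral {a..b} (\<lambda>s. f s * integral {s..b} (\<lambda>t. w t s * u t))"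
proof -
  from w obtain q W E where q: "q < 1"
    and W: "\<And>n. continuous_on ({a..b} \<times> {a..b}) (\<lambda>(t, s). W n t s)"
    and W0: "\<And>n t s. t \<le> s \<Longrightarrow> W n t s = 0" and E: "E \<longlonglongrightarrow> (0::real)"
    and le: "\<And>n t s. a \<le> s \<Longrightarrow> s \<le> t \<Longrightarrow> t \<le> b \<Longrightarrow> \<bar>w t s - W (n::nat) t s\<bar> \<le> E n * (t - s) powr (- q)"
    unfolding weakly_singular_def by metis
  \<comment> \<open>A bound for the integral of the singular weight over every subinterval, which
    makes the error estimates uniform.\<close>
  define D where "D = (b - a) powr (1 - q) / (1 - q)"
  have W1: "continuous_on {a..b} (\<lambda>s. W n t s)" if "t \<in> {a..b}" for n t
    using that by (intro continuous_on_compose2[OF W[of n], of _ "\<lambda>s. (t, s)", simplified] continuous_intros) auto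
  have W2: "continuous_on {a..b} (\<lambda>t. W n t s)" if "s \<in> {a..b}" for n s
    using that by (intro continuous_on_compose2[OF W[of n], of _ "\<lambda>t. (t, s)", simplified] continuous_intros) auto
  have cont_prod: "continuous_on ({a..b} \<times> {a..b}) (\<lambda>(t, s). W n t s * (u s * v t))"
    if "continuous_on {a..b} u" "continuous_on {a..b} v" for u v n
  proof -
    have "continuous_on ({a..b} \<times> {a..b}) (\<lambda>p. (case p of (t, s) \<Rightarrow> W n t s) * (u (snd p) * v (fst p)))"
      using W[of n]
      by (intro continuous_intros continuous_on_compose2[OF that(1)] continuous_on_compose2[OF that(2)]) auto
    then show ?thesis by (simp add: case_prod_unfold)
  qed
  have Wflip: "continuous_on ({a..b} \<times> {a..b}) (\<lambda>(s, t). W n t s * g t)" 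
    if "continuous_on {a..b} g" for g n
  proof -
    have "continuous_on ({a..b} \<times> {a..b}) (\<lambda>p. (case (snd p, fst p) of (t, s) \<Rightarrow> W n t s) * g (snd p))"
      by (intro continuous_intros continuous_on_compose2[OF that] continuous_on_compose2[OF W[of n]]) auto
    then show ?thesis by (simp add: case_prod_unfold)
  qed

  have Dle: "(t - s) powr (1 - q) / (1 - q) \<le> D" if "a \<le> s" "s \<le> t" "t \<le> b" for s t
    unfolding D_def using that q by (intro divide_right_mono powr_mono2) auto

  have left: "(\<lambda>s. w t s * g s) integrable_on {a..t} \<and>
      \<bar>integral {a..t} (\<lambda>s. w t s * g s) - integral {a..b} (\<lambda>s. W n t s * g s)\<bar> \<le> \<bar>E n\<bar> * B * D"
    if g: "continuous_on {a..b} g" "\<And>x. x \<in> {a..b} \<Longrightarrow> \<bar>g x\<bar> \<le> B" and t: "t \<in> {a..b}" for g B t n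
  proof -
    have "0 \<le> B" using g(2)[OF t] by linarith
    have ti: "((\<lambda>s. (t - s) powr (- q)) has_integral ((t - a) powr (1 - q) / (1 - q))) {a..t}"
      using q t by (intro has_integral_powr_diff) auto
    have c: "continuous_on {a..t} (\<lambda>s. W k t s * g s)" for k
      using t by (intro continuous_on_subset[OF continuous_on_mult[OF W1 g(1)]]) auto
    have bd: "\<bar>w t s * g s - W k t s * g s\<bar> \<le> (\<bar>E k\<bar> * B) * (t - s) powr (- q)" if "s \<in> {a..t}" for s k
    proof -
      have "\<bar>w t s * g s - W k t s * g s\<bar> = \<bar>w t s - W k t s\<bar> * \<bar>g s\<bar>"
        by (simp add: left_diff_distrib flip: abs_mult)
      also have "\<dots> \<le> (\<bar>E k\<bar> * (t - s) powr (- q)) * B"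
      proof (rule mult_mono)
        have "E k * (t - s) powr - q \<le> \<bar>E k\<bar> * (t - s) powr - q"
          by (intro mult_right_mono) auto
        then show "\<bar>w t s - W k t s\<bar> \<le> \<bar>E k\<bar> * (t - s) powr - q"
          using le[of s t k] that t by simp
      qed (use g(2)[of s] that t in auto)
      finally show ?thesis by (simp add: mult_ac)
    qed
    have lim: "(\<lambda>k. \<bar>E k\<bar> * B) \<longlonglongrightarrow> 0"
      using tendsto_mult_right[OF tendsto_rabs_zero[OF E], of B] by simp
    note I = integrable_limit_bound[OF c has_integral_integrable[OF ti] _ lim bd, simplified]
    \<comment> \<open>Since \<open>W n\<close> vanishes for \<open>t \<le> s\<close>, its integral
      can be taken over the fixed interval \<open>{a..b}\<close>. This gives a parameter integral
      with a constant domain.\<close>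
    have "integral {a..b} (\<lambda>s. W n t s * g s) = integral {a..t} (\<lambda>s. W n t s * g s)"
      using t W0 by (intro integral_subset_zero) auto
    moreover have "\<bar>E n\<bar> * B * integral {a..t} (\<lambda>s. (t - s) powr (- q)) \<le> \<bar>E n\<bar> * B * D"
      using integral_unique[OF ti] Dle[of a t] t \<open>0 \<le> B\<close> by (intro mult_left_mono) auto
    ultimately show ?thesis
      using I(1) I(2)[of n] by simp
  qed

  have right: "(\<lambda>t. w t s * g t) integrable_on {s..b} \<and>
      \<bar>integral {s..b} (\<lambda>t. w t s * g t) - integral {a..b} (\<lambda>t. W n t s * g t)\<bar> \<le> \<bar>E n\<bar> * B * D"
    if g: "continuous_on {a..b} g" "\<And>x. x \<in> {a..b} \<Longrightarrow> \<bar>g x\<bar> \<le> B" and s: "s \<in> {a..b}" for g B s n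
  proof -
    have "0 \<le> B" using g(2)[OF s] by linarith
    have si: "((\<lambda>t. (t - s) powr (- q)) has_integral ((b - s) powr (1 - q) / (1 - q))) {s..b}"
      using q s by (intro has_integral_powr_diff) auto
    have c: "continuous_on {s..b} (\<lambda>t. W k t s * g t)" for k
      using s by (intro continuous_on_subset[OF continuous_on_mult[OF W2 g(1)]]) auto
    have bd: "\<bar>w t s * g t - W k t s * g t\<bar> \<le> (\<bar>E k\<bar> * B) * (t - s) powr (- q)" if "t \<in> {s..b}" for t k
    proof -
      have "\<bar>w t s * g t - W k t s * g t\<bar> = \<bar>w t s - W k t s\<bar> * \<bar>g t\<bar>"
        by (simp add: left_diff_distrib flip: abs_mult)
      also have "\<dots> \<le> (\<bar>E k\<bar> * (t - s) powr (- q)) * B"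
      proof (rule mult_mono)
        have "E k * (t - s) powr - q \<le> \<bar>E k\<bar> * (t - s) powr - q"
          by (intro mult_right_mono) auto
        then show "\<bar>w t s - W k t s\<bar> \<le> \<bar>E k\<bar> * (t - s) powr - q"
          using le[of s t k] that s by simp
      qed (use g(2)[of t] that s in auto)
      finally show ?thesis by (simp add: mult_ac)
    qed
    have lim: "(\<lambda>k. \<bar>E k\<bar> * B) \<longlonglongrightarrow> 0"
      using tendsto_mult_right[OF tendsto_rabs_zero[OF E], of B] by simp
    note I = integrable_limit_bound[OF c has_integral_integrable[OF si] _ lim bd, simplified]
    have "integral {a..b} (\<lambda>t. W n t s * g t) = integral {s..b} (\<lambda>t. W n t s * g t)"
      using s W0 by (intro integral_subset_zero) auto
    moreover have "\<bar>E n\<bar> * B * integral {s..b} (\<lambda>t. (t - s) powr (- q)) \<le> \<bar>E n\<bar> * B * D"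
      using integral_unique[OF si] Dle[of s b] s \<open>0 \<le> B\<close> by (intro mult_left_mono) auto
    ultimately show ?thesis
      using I(1) I(2)[of n] by simp
  qed

  have bounded: "\<exists>B. \<forall>x\<in>{a..b}. \<bar>g x\<bar> \<le> B" if "continuous_on {a..b} g" for g :: "real \<Rightarrow> real"
    using compact_imp_bounded[OF compact_continuous_image[OF that compact_Icc]]
    by (auto simp: bounded_iff)
  have lim: "(\<lambda>k. \<bar>E k\<bar> * B * D) \<longlonglongrightarrow> 0" for B
    using tendsto_mult_right[OF tendsto_rabs_zero[OF E], of "B * D"] by (simp add: mult.assoc)
  \<comment> \<open>The error bound does not depend on the point, so convergence is uniform and
    continuity survives in the limit.\<close>
  have unif: "uniform_limit {a..b} G h sequentially"
    if "\<And>n x. x \<in> {a..b} \<Longrightarrow> \<bar>h x - G n x\<bar> \<le> \<bar>E n\<bar> * B * D" for G h B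
  proof (rule uniform_limitI)
    fix e :: real assume "0 < e"
    from order_tendstoD(2)[OF lim[of B] this]
    show "\<forall>\<^sub>F n in sequentially. \<forall>x\<in>{a..b}. dist (G n x) (h x) < e"
    proof eventually_elim
      case (elim n)
      then show ?case
        using that[of _ n] by (force simp: dist_real_def abs_minus_commute)
    qed
  qed
  have contL: "continuous_on {a..b} (\<lambda>t. integral {a..b} (\<lambda>s. W n t s * g s))"
    if "continuous_on {a..b} g" for g n
    using integral_continuous_on_param[of "{a..b}" a b "\<lambda>t s. W n t s * g s"]
      cont_prod[OF that continuous_on_const[of _ 1]] by simp
  have contR: "continuous_on {a..b} (\<lambda>s. integral {a..b} (\<lambda>t. W n t s * g t))"
    if "continuous_on {a..b} g" for g n
    using integral_continuous_on_param[of "{a..b}" a b "\<lambda>s t. W n t s * g t"]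
      Wflip[OF that] by simp

  have unifL: "uniform_limit {a..b} (\<lambda>n t. integral {a..b} (\<lambda>s. W n t s * g s))
      (\<lambda>t. integral {a..t} (\<lambda>s. w t s * g s)) sequentially" if g: "continuous_on {a..b} g" for g
  proof -
    obtain B where "\<And>x. x \<in> {a..b} \<Longrightarrow> \<bar>g x\<bar> \<le> B"
      using bounded[OF g] by blast
    then show ?thesis
      using left[OF g] by (intro unif) blast
  qed
  have unifR: "uniform_limit {a..b} (\<lambda>n s. integral {a..b} (\<lambda>t. W n t s * g t))
      (\<lambda>s. integral {s..b} (\<lambda>t. w t s * g t)) sequentially" if g: "continuous_on {a..b} g" for g
  proof -
    obtain B where "\<And>x. x \<in> {a..b} \<Longrightarrow> \<bar>g x\<bar> \<le> B"
      using bounded[OF g] by blast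
    then show ?thesis
      using right[OF g] by (intro unif) blast
  qed

  show "(\<lambda>s. w t s * f s) integrable_on {a..t}" if "t \<in> {a..b}" for t
    using bounded[OF f] left[OF f _ that] by blast
  show "(\<lambda>t. w t s * f t) integrable_on {s..b}" if "s \<in> {a..b}" for s
    using bounded[OF f] right[OF f _ that] by blast
  show "continuous_on {a..b} (\<lambda>t. integral {a..t} (\<lambda>s. w t s * f s))"
    by (rule uniform_limit_theorem[OF _ unifL[OF f]]) (simp_all add: contL f)
  show "continuous_on {a..b} (\<lambda>s. integral {s..b} (\<lambda>t. w t s * f t))"
    by (rule uniform_limit_theorem[OF _ unifR[OF f]]) (simp_all add: contR f)

  \<comment> \<open>Boundedness of \<open>u\<close> and of the limit \<open>h\<close> keeps the
    products uniformly convergent, so their integrals converge.\<close>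
  have mult_lim: "(\<lambda>n. integral {a..b} (\<lambda>x. u x * G n x)) \<longlonglongrightarrow> integral {a..b} (\<lambda>x. u x * h x)"
    if u: "continuous_on {a..b} u" and G: "\<And>n. continuous_on {a..b} (G n)"
      and h: "uniform_limit {a..b} G h sequentially" for u h :: "real \<Rightarrow> real" and G
  proof -
    have "continuous_on {a..b} h"
      by (rule uniform_limit_theorem[OF _ h]) (simp_all add: G)
    then have b: "bounded (h ` {a..b})" "bounded (u ` {a..b})"
      using u compact_imp_bounded compact_continuous_image compact_Icc by blast+
    have "uniform_limit {a..b} (\<lambda>n x. u x * G n x) (\<lambda>x. u x * h x) sequentially"
      by (intro uniform_lim_mult h uniform_limit_const b)
    then obtain I J where IJ: "\<And>n. ((\<lambda>x. u x * G n x) has_integral I n) {a..b}"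
        "((\<lambda>x. u x * h x) has_integral J) {a..b}" "I \<longlonglongrightarrow> J"
      by (rule uniform_limit_integral) (auto intro!: continuous_intros u G)
    then show ?thesis by (simp add: IJ(1,2)[THEN integral_unique])
  qed

  show "integral {a..b} (\<lambda>t. u t * integral {a..t} (\<lambda>s. w t s * f s)) =
      integral {a..b} (\<lambda>s. f s * integral {s..b} (\<lambda>t. w t s * u t))"
    if u: "continuous_on {a..b} u" for u
  proof (rule LIMSEQ_unique)
    show "(\<lambda>n. integral {a..b} (\<lambda>t. u t * integral {a..b} (\<lambda>s. W n t s * f s))) \<longlonglongrightarrow>
        integral {a..b} (\<lambda>t. u t * integral {a..t} (\<lambda>s. w t s * f s))"
      by (intro mult_lim u contL f unifL)
    \<comment> \<open>For a continuous kernel on the square this is Fubini. Both sides then converge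
      to the two sides of the claim.\<close>
    have "integral {a..b} (\<lambda>t. u t * integral {a..b} (\<lambda>s. W n t s * f s)) =
        integral {a..b} (\<lambda>s. f s * integral {a..b} (\<lambda>t. W n t s * u t))" for n
    proof -
      have "continuous_on (cbox (a, a) (b, b)) (\<lambda>(t, s). W n t s * (f s * u t))"
        using cont_prod[OF f u, of n] by (simp add: cbox_Pair_eq)
      from integral_swap_continuous[OF this]
      have "integral {a..b} (\<lambda>t. integral {a..b} (\<lambda>s. W n t s * (f s * u t))) =
          integral {a..b} (\<lambda>s. integral {a..b} (\<lambda>t. W n t s * (f s * u t)))"
        by simp
      then show ?thesis
        by (simp add: mult_ac flip: integral_mult_right)
    qed
    then show "(\<lambda>n. integral {a..b} (\<lambda>t. u t * integral {a..b} (\<lambda>s. W n t s * f s))) \<longlonglongrightarrow>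
        integral {a..b} (\<lambda>s. f s * integral {s..b} (\<lambda>t. w t s * u t))"
      using mult_lim[OF f contR[OF u] unifR[OF u]] by simp
  qed
qed

text \<open>By compactness the order has a maximum \<open>m\<close> below \<open>1\<close> and the
  factor \<open>1 / Gamma\<close> is bounded by \<open>R\<close>. Cutting off the singularity at
  distance \<open>1 / N n\<close> changes the kernel only there, by at most \<open>R\<close> times
  the distance to the power \<open>- m\<close>. An exponent \<open>q\<close> slightly larger than
  \<open>m\<close> leaves a factor that tends to \<open>0\<close>.\<close>

lemma weakly_singular_RL_kernel:
  assumes d: "continuous_on ({a..b} \<times> {a..b}) (\<lambda>(t, s). \<delta> t s)"
    and d01: "\<And>t s. t \<in> {a..b} \<Longrightarrow> s \<in> {a..b} \<Longrightarrow> \<delta> t s \<in> {0<..<1}"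
  shows "weakly_singular a b (\<lambda>t s. (t - s) powr (- \<delta> t s) / Gamma (1 - \<delta> t s))"
proof (cases "a \<le> b")
  case False
  then show ?thesis
    unfolding weakly_singular_def
    by (intro exI[of _ 0] conjI exI[of _ "\<lambda>_ _ _. 0"] exI[of _ "\<lambda>_. 0"]) auto
next
  case True
  let ?Q = "{a..b} \<times> {a..b}"
  let ?w = "\<lambda>t s. (t - s) powr (- \<delta> t s) / Gamma (1 - \<delta> t s)"
  have Q: "compact ?Q" "?Q \<noteq> {}"
    using True by (auto intro: compact_Times)
  obtain p where p: "p \<in> ?Q" "\<And>r. r \<in> ?Q \<Longrightarrow> (case r of (t, s) \<Rightarrow> \<delta> t s) \<le> (case p of (t, s) \<Rightarrow> \<delta> t s)"
    using continuous_attains_sup[OF Q d] by blast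
  define m where "m = (case p of (t, s) \<Rightarrow> \<delta> t s)"
  have m: "0 < m" "m < 1" "\<And>t s. t \<in> {a..b} \<Longrightarrow> s \<in> {a..b} \<Longrightarrow> \<delta> t s \<le> m"
    using p d01 unfolding m_def by force+
  \<comment> \<open>The reciprocal Gamma function is entire, so its continuity needs no discussion
    of poles.\<close>
  have cG: "continuous_on ?Q (\<lambda>p. rGamma (1 - (case p of (t, s) \<Rightarrow> \<delta> t s)))"
    by (intro continuous_on_compose2[OF continuous_on_rGamma[of UNIV]] continuous_intros d) auto
  obtain R where R: "\<And>t s. t \<in> {a..b} \<Longrightarrow> s \<in> {a..b} \<Longrightarrow> \<bar>rGamma (1 - \<delta> t s)\<bar> \<le> R"
    using compact_imp_bounded[OF compact_continuous_image[OF cG Q(1)]]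
    unfolding bounded_iff by fastforce
  \<comment> \<open>The midpoint between \<open>m\<close> and \<open>1\<close> keeps the weight
    integrable while \<open>q - m\<close> is positive, so that \<open>E\<close> tends to
    \<open>0\<close>. In \<open>W\<close> the \<open>max\<close> truncates the singularity and the
    last factor is a ramp from \<open>0\<close> at \<open>t = s\<close> to \<open>1\<close> at
    \<open>t - s = 1 / N n\<close>.\<close>
  define q where "q = (1 + m) / 2"
  define N where "N n = real (Suc n)" for n
  define W where "W n t s =
    max (t - s) (1 / N n) powr (- \<delta> t s) * rGamma (1 - \<delta> t s) * min 1 (max 0 (N n * (t - s)))" for n t s
  define E where "E n = R * (1 / N n) powr (q - m)" for n
  have N: "N n > 0" for n by (simp add: N_def)
  have "q < 1" using m by (simp add: q_def)
  moreover have "continuous_on ?Q (\<lambda>(t, s). W n t s)" for n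
  proof -
    \<comment> \<open>The truncated base never vanishes, hence \<open>powr\<close> is continuous in
      base and exponent together.\<close>
    have "max (fst p - snd p) (1 / N n) \<noteq> 0" for p
      using N[of n] by (metis less_max_iff_disj less_numeral_extra(3) zero_less_divide_1_iff)
    then have "continuous_on ?Q (\<lambda>p. max (fst p - snd p) (1 / N n) powr (- (case p of (t, s) \<Rightarrow> \<delta> t s)) *
        rGamma (1 - (case p of (t, s) \<Rightarrow> \<delta> t s)) * min 1 (max 0 (N n * (fst p - snd p))))"
      by (intro continuous_on_compose2[OF continuous_on_rGamma[of UNIV]] continuous_intros d) auto
    then show ?thesis by (simp add: W_def case_prod_unfold)
  qed
  moreover have "W n t s = 0" if "t \<le> s" for n t s
  proof -
    have "N n * (t - s) \<le> 0"
      using that N[of n] by (simp add: mult_nonneg_nonpos)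
    then show ?thesis by (simp add: W_def)
  qed
  moreover have "E \<longlonglongrightarrow> 0"
  proof -
    have "(\<lambda>n. (1 / N n) powr (q - m)) \<longlonglongrightarrow> 0"
      unfolding N_def using m
      by (intro tendsto_zero_powrI[where b = "q - m"] LIMSEQ_Suc[OF lim_1_over_n]) (auto simp: q_def)
    from tendsto_mult_right_zero[OF this, of R]
    show ?thesis by (simp add: E_def[abs_def])
  qed
  moreover have "\<bar>?w t s - W n t s\<bar> \<le> E n * (t - s) powr (- q)"
    if "a \<le> s" "s \<le> t" "t \<le> b" for n t s
  proof -
    define z \<delta>' G where "z = t - s" and "\<delta>' = \<delta> t s" and "G = rGamma (1 - \<delta> t s)"
    have ts: "t \<in> {a..b}" "s \<in> {a..b}" using that by auto
    have d': "0 < \<delta>'" "\<delta>' < 1" "\<delta>' \<le> m"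
      using d01[OF ts] m(3)[OF ts] by (auto simp: \<delta>'_def)
    have G: "0 \<le> G" "G \<le> R"
      using R[OF ts] d01[OF ts] by (auto simp: G_def rGamma_inverse_Gamma Gamma_real_nonneg)
    have w: "?w t s = z powr (- \<delta>') * G"
      by (simp add: z_def \<delta>'_def G_def rGamma_inverse_Gamma divide_inverse)
    have W: "W n t s = max z (1 / N n) powr (- \<delta>') * G * min 1 (max 0 (N n * z))"
      by (simp add: W_def z_def \<delta>'_def G_def)
    have E0: "0 \<le> E n" using G by (simp add: E_def)
    consider "z = 0" | "0 < z" "z < 1 / N n" | "1 / N n \<le> z"
      using \<open>s \<le> t\<close> by (cases "t = s"; cases "z < 1 / N n") (auto simp: z_def)
    then have "\<bar>z powr (- \<delta>') * G - W n t s\<bar> \<le> E n * z powr (- q)"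
    proof cases
      \<comment> \<open>Since \<open>0 powr r = 0\<close>, kernel, approximation and weight all
        vanish on the diagonal.\<close>
      case 1
      then show ?thesis by (simp add: W)
    next
      case 2
      have Nz: "N n * z < 1" "0 < N n * z" using 2 N[of n] by (auto simp: field_simps)
      have "W n t s = (1 / N n) powr (- \<delta>') * G * (N n * z)"
        using 2 Nz by (simp add: W max_def)
      moreover have "(1 / N n) powr (- \<delta>') * G * (N n * z) \<le> z powr (- \<delta>') * G * 1"
        using 2 d' G Nz by (intro mult_mono powr_mono2') auto
      moreover have "0 \<le> (1 / N n) powr (- \<delta>') * G * (N n * z)"
        using G Nz by auto
      ultimately have "\<bar>z powr (- \<delta>') * G - W n t s\<bar> \<le> z powr (- \<delta>') * G"
        by simp
      also have "\<dots> \<le> z powr (- m) * R"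
      proof (intro mult_mono powr_mono')
        \<comment> \<open>Lowering the exponent from \<open>- \<delta>'\<close> to
          \<open>- m\<close> increases the power only for a base at most \<open>1\<close>; this is
          why \<open>N n\<close> starts at \<open>1\<close>.\<close>
        show "z \<le> 1" using 2 N[of n] by (auto simp: N_def field_simps intro: order_trans[of z "1 / (1 + n)"])
      qed (use 2 d' G in auto)
      also have "\<dots> = R * z powr (q - m) * z powr (- q)"
        using 2 by (simp flip: powr_add)
      also have "\<dots> \<le> E n * z powr (- q)"
        unfolding E_def using 2 m G by (intro mult_right_mono mult_left_mono powr_mono2) (auto simp: q_def)
      finally show ?thesis .
    next
      case 3
      then have "1 \<le> N n * z" using N[of n] by (simp add: field_simps)
      then have "W n t s = z powr (- \<delta>') * G" using 3 by (simp add: W max_def)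
      then show ?thesis using E0 by simp
    qed
    then show ?thesis unfolding w by (simp add: z_def)
  qed
  ultimately show ?thesis
    unfolding weakly_singular_def by (intro exI[of _ q] conjI exI[of _ W] exI[of _ E]) auto
qed

section \<open>A multiplier rule in the plane\<close>

text \<open>Suppose the conclusion fails. Then \<open>J\<close> has nonzero slope along the
  direction \<open>(1, r0)\<close> that spans the kernel of \<open>K'\<close>, and the slope keeps
  its sign in a narrow cone around that direction. On a suitable short vertical segment of the cone
  \<open>J\<close> lies below \<open>J 0\<close>, while \<open>K\<close> takes values of opposite
  sign at its ends. A zero of \<open>K\<close> on the segment contradicts minimality.
  Differentiability is used only at the origin.\<close>

lemma multiplier_rule_plane:
  fixes J K :: "real \<times> real \<Rightarrow> real"
  assumes J: "(J has_derivative J') (at 0)" and K: "(K has_derivative K') (at 0)"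
    and K0: "K 0 = 0" and K': "K' (0, 1) \<noteq> 0"
    and cont: "\<forall>\<^sub>F e in at 0. continuous_on UNIV (\<lambda>r. K (e, r))"
    and min: "\<forall>\<^sub>F p in nhds 0. K p = 0 \<longrightarrow> J 0 \<le> J p"
  shows "J' (1, 0) * K' (0, 1) = K' (1, 0) * J' (0, 1)"
proof -
  interpret J: bounded_linear J' using J by (rule has_derivative_bounded_linear)
  interpret K: bounded_linear K' using K by (rule has_derivative_bounded_linear)
  define r0 where "r0 = - K' (1, 0) / K' (0, 1)"
  have split: "(1, r) = (1, 0) + r *\<^sub>R (0 :: real, 1 :: real)" for r by simp
  have K'r: "K' (1, r) = (r - r0) * K' (0, 1)" for r
    unfolding split[of r] K.add K.scaleR using K' by (simp add: r0_def field_simps)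
  have J'r: "J' (1, r) = J' (1, 0) + r * J' (0, 1)" for r
    unfolding split[of r] J.add J.scaleR by simp
  have "J' (1, r0) = 0"
  proof (rule ccontr)
    assume ne: "J' (1, r0) \<noteq> 0"
    \<comment> \<open>Half of the slope at \<open>r0\<close> is kept throughout the cone; the other
      half will absorb the error of linearization.\<close>
    obtain \<eta> where \<eta>: "0 < \<eta>" "\<And>r. \<bar>r - r0\<bar> \<le> \<eta> \<Longrightarrow> sgn (J' (1, r0)) * J' (1, r) \<ge> \<bar>J' (1, r0)\<bar> / 2"
    proof
      let ?\<eta> = "\<bar>J' (1, r0)\<bar> / (2 * (1 + \<bar>J' (0, 1)\<bar>))"
      show "0 < ?\<eta>" using ne by simp
      fix r assume r: "\<bar>r - r0\<bar> \<le> ?\<eta>"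
      have "\<bar>J' (1, r) - J' (1, r0)\<bar> = \<bar>r - r0\<bar> * \<bar>J' (0, 1)\<bar>"
        unfolding J'r[of r] J'r[of r0] by (simp add: left_diff_distrib flip: abs_mult)
      also have "\<dots> \<le> ?\<eta> * (1 + \<bar>J' (0, 1)\<bar>)"
        using r by (intro mult_mono) auto
      also have "\<dots> = \<bar>J' (1, r0)\<bar> / 2" by (simp add: field_simps)
      finally show "sgn (J' (1, r0)) * J' (1, r) \<ge> \<bar>J' (1, r0)\<bar> / 2"
        using ne by (cases "J' (1, r0) > 0"; simp add: sgn_if; arith)
    qed
    \<comment> \<open>A bound for the norm of \<open>(1, r)\<close> over all slopes \<open>r\<close>
      in the cone.\<close>
    define B where "B = 1 + \<bar>r0\<bar> + \<eta>"
    have nB: "norm (e, e * r) \<le> \<bar>e\<bar> * B" if "\<bar>r - r0\<bar> \<le> \<eta>" for e r :: real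
    proof -
      have "norm (e, e * r) \<le> \<bar>e\<bar> + \<bar>e * r\<bar>" using norm_Pair_le[of e "e * r"] by simp
      also have "\<dots> = \<bar>e\<bar> * (1 + \<bar>r\<bar>)" by (simp add: abs_mult algebra_simps)
      also have "\<dots> \<le> \<bar>e\<bar> * B" using that by (intro mult_left_mono) (auto simp: B_def)
      finally show ?thesis .
    qed
    have B: "B > 0" using \<eta> by (simp add: B_def)
    \<comment> \<open>The linearization error is small compared with \<open>\<bar>e\<bar>\<close>,
      uniformly over the slopes in the cone. The factor \<open>2\<close> in
      \<open>c / (2 * B)\<close> below makes the inequality strict.\<close>
    have small: "\<exists>d>0. \<forall>e r. 0 < \<bar>e\<bar> \<longrightarrow> \<bar>e\<bar> < d \<longrightarrow> \<bar>r - r0\<bar> \<le> \<eta> \<longrightarrow>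
        \<bar>f (e, e * r) - f 0 - e * f' (1, r)\<bar> < c * \<bar>e\<bar>"
      if f: "(f has_derivative f') (at 0)" and c: "c > 0" for f f' :: "real \<times> real \<Rightarrow> real" and c
    proof -
      interpret f: bounded_linear f' using f by (rule has_derivative_bounded_linear)
      obtain d where d: "d > 0" "\<And>p. norm p < d \<Longrightarrow> \<bar>f p - f 0 - f' p\<bar> \<le> c / (2 * B) * norm p"
      proof -
        have "0 < c / (2 * B)" using B c by simp
        with f obtain d where "d > 0" "\<forall>p. norm (p - 0) < d \<longrightarrow>
            norm (f p - f 0 - f' (p - 0)) \<le> c / (2 * B) * norm (p - 0)"
          unfolding has_derivative_at_alt by blast
        then show ?thesis by (intro that[of d]) auto
      qed
      have "\<bar>f (e, e * r) - f 0 - e * f' (1, r)\<bar> < c * \<bar>e\<bar>"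
        if e: "0 < \<bar>e\<bar>" "\<bar>e\<bar> < d / B" and r: "\<bar>r - r0\<bar> \<le> \<eta>" for e r
      proof -
        have "norm (e, e * r) < d"
          using nB[OF r, of e] e B by (simp add: field_simps)
        then have "\<bar>f (e, e * r) - f 0 - f' (e, e * r)\<bar> \<le> c / (2 * B) * norm (e, e * r)"
          by (rule d)
        also have "\<dots> \<le> c / (2 * B) * (\<bar>e\<bar> * B)"
          using nB[OF r] B c by (intro mult_left_mono) auto
        also have "\<dots> = c / 2 * \<bar>e\<bar>" using B by simp
        also have "\<dots> < c * \<bar>e\<bar>" using c e by simp
        finally show ?thesis using f.scaleR[of e "(1, r)"] by simp
      qed
      then show ?thesis using d(1) B by (intro exI[of _ "d / B"]) simp
    qed
    obtain dJ where dJ: "dJ > 0" "\<And>e r. 0 < \<bar>e\<bar> \<Longrightarrow> \<bar>e\<bar> < dJ \<Longrightarrow> \<bar>r - r0\<bar> \<le> \<eta> \<Longrightarrow>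
        \<bar>J (e, e * r) - J 0 - e * J' (1, r)\<bar> < \<bar>J' (1, r0)\<bar> / 2 * \<bar>e\<bar>"
      using small[OF J, of "\<bar>J' (1, r0)\<bar> / 2"] ne by auto
    obtain dK where dK: "dK > 0" "\<And>e r. 0 < \<bar>e\<bar> \<Longrightarrow> \<bar>e\<bar> < dK \<Longrightarrow> \<bar>r - r0\<bar> \<le> \<eta> \<Longrightarrow>
        \<bar>K (e, e * r) - e * K' (1, r)\<bar> < \<eta> * \<bar>K' (0, 1)\<bar> * \<bar>e\<bar>"
      using small[OF K, of "\<eta> * \<bar>K' (0, 1)\<bar>"] K' \<eta> K0 by auto
    obtain dc where dc: "dc > 0" "\<And>e. 0 < \<bar>e\<bar> \<Longrightarrow> \<bar>e\<bar> < dc \<Longrightarrow> continuous_on UNIV (\<lambda>r. K (e, r))"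
      using cont unfolding eventually_at by (auto simp: dist_real_def)
    obtain dm where dm: "dm > 0" "\<And>p. norm p < dm \<Longrightarrow> K p = 0 \<Longrightarrow> J 0 \<le> J p"
      using min unfolding eventually_nhds_metric by (auto simp: dist_norm)
    have "0 < dm / B" using dm(1) B by simp
    then have "0 < Min {dJ, dK, dc, dm / B}" using dJ(1) dK(1) dc(1) by simp
    then obtain d where "0 < d" "d < Min {dJ, dK, dc, dm / B}" using dense by blast
    then have d: "0 < d" "d < dJ" "d < dK" "d < dc" "d < dm / B" by auto
    \<comment> \<open>The sign of \<open>e\<close> is opposite to that of the slope, so that
      \<open>J\<close> decreases to first order.\<close>
    define e where "e = - sgn (J' (1, r0)) * d"
    have e: "\<bar>e\<bar> = d" using ne d by (simp add: e_def abs_mult abs_sgn_eq)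
    have "\<exists>r. \<bar>r - r0\<bar> \<le> \<eta> \<and> K (e, e * r) = 0"
    proof -
      have c: "continuous_on {r0 - \<eta>..r0 + \<eta>} (\<lambda>r. K (e, e * r))"
        using dc(2)[of e] e d
        by (intro continuous_on_compose2[of UNIV "\<lambda>r. K (e, r)" _ "\<lambda>r. e * r"] continuous_intros) auto
      have up: "\<bar>K (e, e * (r0 + \<eta>)) - e * (\<eta> * K' (0, 1))\<bar> < \<bar>e * (\<eta> * K' (0, 1))\<bar>"
        using dK(2)[of e "r0 + \<eta>"] e d \<eta> by (simp add: K'r abs_mult mult_ac)
      have dn: "\<bar>K (e, e * (r0 - \<eta>)) + e * (\<eta> * K' (0, 1))\<bar> < \<bar>e * (\<eta> * K' (0, 1))\<bar>"
        using dK(2)[of e "r0 - \<eta>"] e d \<eta> by (simp add: K'r abs_mult mult_ac)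
      \<comment> \<open>At the two extreme slopes \<open>K\<close> has the signs of
        \<open>e * K' (0, 1)\<close> and of its negative. Which end is which depends on signs not
        fixed here, hence two cases.\<close>
      from up dn consider "K (e, e * (r0 - \<eta>)) \<le> 0" "0 \<le> K (e, e * (r0 + \<eta>))"
        | "K (e, e * (r0 + \<eta>)) \<le> 0" "0 \<le> K (e, e * (r0 - \<eta>))" by linarith
      then show ?thesis
      proof cases
        case 1
        then show ?thesis using IVT'[OF _ _ _ c, of 0] \<eta> by (force simp: abs_le_iff)
      next
        case 2
        then show ?thesis using IVT2'[OF _ _ _ c, of 0] \<eta> by (force simp: abs_le_iff)
      qed
    qed
    then obtain r where r: "\<bar>r - r0\<bar> \<le> \<eta>" "K (e, e * r) = 0" by blast
    have "norm (e, e * r) < dm"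
      using nB[OF r(1), of e] d(5) e B by (simp add: field_simps)
    then have "J 0 \<le> J (e, e * r)" using dm(2) r by blast
    \<comment> \<open>The first-order decrease is at least
      \<open>d * \<bar>J' (1, r0)\<bar> / 2\<close> and the error is strictly less, so
      \<open>J (e, e * r) < J 0\<close>.\<close>
    moreover have "J (e, e * r) - J 0 - e * J' (1, r) < \<bar>J' (1, r0)\<bar> / 2 * d"
    proof -
      have "\<bar>J (e, e * r) - J 0 - e * J' (1, r)\<bar> < \<bar>J' (1, r0)\<bar> / 2 * \<bar>e\<bar>"
        using e d r(1) by (intro dJ(2)) auto
      then show ?thesis unfolding e abs_less_iff by blast
    qed
    moreover have "e * J' (1, r) = - d * (sgn (J' (1, r0)) * J' (1, r))"
      by (simp add: e_def)
    moreover have "d * (sgn (J' (1, r0)) * J' (1, r)) \<ge> d * (\<bar>J' (1, r0)\<bar> / 2)"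
      using \<eta>(2)[OF r(1)] d by (intro mult_left_mono) auto
    ultimately show False by (simp add: mult_ac)
  qed
  \<comment> \<open>Vanishing of \<open>J'\<close> on the kernel vector \<open>(1, r0)\<close> is
    the claim after clearing the denominator of \<open>r0\<close>.\<close>
  then show ?thesis
    using K' J'r[of r0] by (simp add: r0_def field_simps)
qed

section \<open>Differentiating functionals with a moving end point\<close>

text \<open>The fibre over \<open>t\<close> is the whole second factor, so the derivative along it
  is unrestricted even if \<open>t\<close> is an end point.\<close>

lemma has_derivative_slice:
  fixes M :: "real \<times> 'a::real_normed_vector \<Rightarrow> real"
  assumes "(M has_derivative D) (at (t, p) within S \<times> UNIV)" "t \<in> S"
  shows "((\<lambda>q. M (t, q)) has_derivative (\<lambda>d. D (0, d))) (at p)"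
proof (rule has_derivative_in_compose[of "\<lambda>q. (t, q)"])
  show "((\<lambda>q. (t, q)) has_derivative (\<lambda>d. (0, d))) (at p)"
    by (auto intro!: derivative_eq_intros)
  show "(M has_derivative D) (at (t, p) within range (Pair t))"
    using assms by (auto intro: has_derivative_subset)
qed

text \<open>Identifies the partial derivatives, defined by \<open>deriv\<close>, with values of the
  total derivative. The third claim supplies the chain rule for perturbations at fixed time.\<close>

lemma pd_eq:
  assumes M: "(M has_derivative D) (at (t, u, v) within {a..b} \<times> UNIV)" and t: "t \<in> {a..b}"
  shows "pd2 M (t, u, v) = D (0, 1, 0)" and "pd3 M (t, u, v) = D (0, 0, 1)"
    and "((\<lambda>p. M (t, p)) has_derivative (\<lambda>(h, k). pd2 M (t, u, v) * h + pd3 M (t, u, v) * k)) (at (u, v))"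
proof -
  interpret D: bounded_linear D using M by (rule has_derivative_bounded_linear)
  have slice: "((\<lambda>p. M (t, p)) has_derivative (\<lambda>d. D (0, d))) (at (u, v))"
    using M t by (rule has_derivative_slice)
  have "((\<lambda>w. M (t, w, v)) has_derivative (\<lambda>h. D (0, h, 0))) (at u)"
    by (rule has_derivative_compose[where f = "\<lambda>w. (w, v)", OF _ slice]) (auto intro!: derivative_eq_intros)
  moreover have "(\<lambda>h. D (0, h, 0)) = (*) (D (0, 1, 0))"
  proof
    show "D (0, h, 0) = D (0, 1, 0) * h" for h
      using D.scaleR[of h "(0, 1, 0)"] by simp
  qed
  ultimately show p2: "pd2 M (t, u, v) = D (0, 1, 0)"
    by (simp add: pd2_def DERIV_imp_deriv has_field_derivative_def)
  have "((\<lambda>w. M (t, u, w)) has_derivative (\<lambda>h. D (0, 0, h))) (at v)"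
    by (rule has_derivative_compose[where f = "\<lambda>w. (u, w)", OF _ slice]) (auto intro!: derivative_eq_intros)
  moreover have "(\<lambda>h. D (0, 0, h)) = (*) (D (0, 0, 1))"
  proof
    show "D (0, 0, h) = D (0, 0, 1) * h" for h
      using D.scaleR[of h "(0, 0, 1)"] by simp
  qed
  ultimately show p3: "pd3 M (t, u, v) = D (0, 0, 1)"
    by (simp add: pd3_def DERIV_imp_deriv has_field_derivative_def)
  have "D (0, d) = (case d of (h, k) \<Rightarrow> pd2 M (t, u, v) * h + pd3 M (t, u, v) * k)" for d
  proof -
    have "(0, d) = fst d *\<^sub>R (0, 1, 0) + snd d *\<^sub>R (0 :: real, 0 :: real, 1 :: real)"
      by (simp add: prod_eq_iff)
    then have "D (0, d) = fst d *\<^sub>R D (0, 1, 0) + snd d *\<^sub>R D (0, 0, 1)"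
      by (simp only: D.add D.scaleR)
    then show ?thesis
      by (simp add: p2 p3 case_prod_unfold)
  qed
  then show "((\<lambda>p. M (t, p)) has_derivative
      (\<lambda>(h, k). pd2 M (t, u, v) * h + pd3 M (t, u, v) * k)) (at (u, v))"
    using slice by simp
qed

text \<open>At an interior time the strip is a neighbourhood of the point, so the one-sided
  convention in \<open>pd1_phi\<close> gives the ordinary partial derivative.\<close>

lemma pd_phi_eq:
  assumes \<phi>: "(\<phi> has_derivative D) (at (t, u) within {a..b} \<times> UNIV)" and t: "t \<in> {a<..<b}"
  shows "(\<phi> has_derivative (\<lambda>(h, k). pd1_phi a b \<phi> (t, u) * h + pd2_phi \<phi> (t, u) * k)) (at (t, u))"
proof -
  interpret D: bounded_linear D using \<phi> by (rule has_derivative_bounded_linear)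
  have tab: "t \<in> {a..b}" "a < b" using t by auto
  have "((\<lambda>w. \<phi> (t, w)) has_derivative (\<lambda>d. D (0, d))) (at u)"
    using \<phi> tab(1) by (rule has_derivative_slice)
  moreover have "(\<lambda>h. D (0, h)) = (*) (D (0, 1))"
  proof
    show "D (0, h) = D (0, 1) * h" for h
      using D.scaleR[of h "(0, 1)"] by simp
  qed
  ultimately have p2: "pd2_phi \<phi> (t, u) = D (0, 1)"
    by (simp add: pd2_phi_def DERIV_imp_deriv has_field_derivative_def)
  have "((\<lambda>s. \<phi> (s, u)) has_derivative (\<lambda>h. D (h, 0))) (at t within {a..b})"
  proof (rule has_derivative_in_compose[of "\<lambda>s. (s, u)"])
    show "((\<lambda>s. (s, u)) has_derivative (\<lambda>d. (d, 0))) (at t within {a..b})"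
      by (auto intro!: derivative_eq_intros)
    show "(\<phi> has_derivative D) (at (t, u) within (\<lambda>s. (s, u)) ` {a..b})"
      using \<phi> by (auto intro: has_derivative_subset)
  qed
  moreover have "(\<lambda>h. D (h, 0)) = (\<lambda>h. h *\<^sub>R D (1, 0))"
  proof
    show "D (h, 0) = h *\<^sub>R D (1, 0)" for h
      using D.scaleR[of h "(1, 0)"] by simp
  qed
  ultimately have p1: "pd1_phi a b \<phi> (t, u) = D (1, 0)"
    unfolding pd1_phi_def derivI_def prod.case
    using tab by (intro vector_derivative_within_closed_interval) (simp_all add: has_vector_derivative_def)
  have "D d = (case d of (h, k) \<Rightarrow> pd1_phi a b \<phi> (t, u) * h + pd2_phi \<phi> (t, u) * k)" for d
  proof -
    have "d = fst d *\<^sub>R (1, 0) + snd d *\<^sub>R (0 :: real, 1 :: real)"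
      by (simp add: prod_eq_iff)
    then have "D d = fst d *\<^sub>R D (1, 0) + snd d *\<^sub>R D (0, 1)"
      using D.add D.scaleR by metis
    then show ?thesis
      by (simp add: p1 p2 case_prod_unfold)
  qed
  then have D: "D = (\<lambda>(h, k). pd1_phi a b \<phi> (t, u) * h + pd2_phi \<phi> (t, u) * k)"
    by auto
  have "at (t, u) within {a..b} \<times> UNIV = at (t, u)"
  proof (rule at_within_interior)
    show "(t, u) \<in> interior ({a..b} \<times> UNIV)"
      using t by (simp add: interior_Times)
  qed
  then show ?thesis using \<phi> D by simp
qed

lemma C1_on_imp_continuous_pd:
  assumes "C1_on g ({a..b} \<times> UNIV)"
  shows "g differentiable_on {a..b} \<times> UNIV"
    and "continuous_on ({a..b} \<times> UNIV) (pd2 g)" "continuous_on ({a..b} \<times> UNIV) (pd3 g)"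
proof -
  from assms obtain g' where c: "continuous_on ({a..b} \<times> UNIV) g'"
    and g': "\<And>p. p \<in> {a..b} \<times> UNIV \<Longrightarrow> (g has_derivative blinfun_apply (g' p)) (at p within {a..b} \<times> UNIV)"
    unfolding C1_on_def by blast
  show "g differentiable_on {a..b} \<times> UNIV"
    using g' unfolding differentiable_on_def differentiable_def by blast
  have "pd2 g p = g' p (0, 1, 0)" "pd3 g p = g' p (0, 0, 1)" if "p \<in> {a..b} \<times> UNIV" for p
    using that g'[of p] by (cases p; auto intro: pd_eq)+
  moreover have "continuous_on ({a..b} \<times> UNIV) (\<lambda>p. g' p d)" for d
    using c by (intro continuous_intros)
  ultimately show "continuous_on ({a..b} \<times> UNIV) (pd2 g)" "continuous_on ({a..b} \<times> UNIV) (pd3 g)"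
    by (auto cong: continuous_on_cong)
qed

text \<open>Since \<open>deriv\<close> is a choice of value, it splits over the combination only
  because both functions are differentiable. This is used for
  \<open>F = L - \<lambda> g\<close>.\<close>

lemma pd_diff_cmult:
  assumes "L differentiable_on {a..b} \<times> UNIV" "g differentiable_on {a..b} \<times> UNIV" "p \<in> {a..b} \<times> UNIV"
  shows "pd2 (\<lambda>p. L p - c * g p) p = pd2 L p - c * pd2 g p"
    and "pd3 (\<lambda>p. L p - c * g p) p = pd3 L p - c * pd3 g p"
proof -
  obtain t u v where p: "p = (t, u, v)" "t \<in> {a..b}" using assms(3) by auto
  obtain L' g' where "(L has_derivative L') (at (t, u, v) within {a..b} \<times> UNIV)"
    "(g has_derivative g') (at (t, u, v) within {a..b} \<times> UNIV)"
    using assms unfolding differentiable_on_def differentiable_def p(1) by blast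
  note D = this has_derivative_diff[OF this(1) has_derivative_mult_right[OF this(2)]]
  show "pd2 (\<lambda>p. L p - c * g p) p = pd2 L p - c * pd2 g p"
    and "pd3 (\<lambda>p. L p - c * g p) p = pd3 L p - c * pd3 g p"
    using D[THEN pd_eq(1), OF p(2)] D[THEN pd_eq(2), OF p(2)] by (simp_all add: p(1))
qed

text \<open>The difference is an integral over the short interval between \<open>T\<close> and
  \<open>s\<close>, where joint continuity keeps \<open>N e\<close> close to \<open>N 0 T\<close>.
  Varying \<open>e\<close> therefore contributes nothing to first order.\<close>

lemma moving_endpoint_has_derivative:
  fixes N :: "'e::real_normed_vector \<Rightarrow> real \<Rightarrow> real"
  assumes T: "a < T" "T < b" and N: "continuous_on (UNIV \<times> {a..b}) (\<lambda>(e, t). N e t)"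
  shows "((\<lambda>(s, e). integral {a..s} (N e) - integral {a..T} (N e)) has_derivative
    (\<lambda>(ds, de). ds * N 0 T)) (at (T, 0))"
  unfolding has_derivative_at_alt
proof (intro conjI allI impI)
  show "bounded_linear (\<lambda>(ds, de :: 'e). ds * N 0 T)"
    unfolding case_prod_unfold by (intro bounded_linear_mult_const bounded_linear_fst)
  fix \<epsilon> :: real assume "0 < \<epsilon>"
  then obtain d0 where d0: "d0 > 0" "\<And>e t. t \<in> {a..b} \<Longrightarrow> dist (e, t) (0, T) < d0 \<Longrightarrow> dist (N e t) (N 0 T) < \<epsilon>"
    using N[unfolded continuous_on_iff, rule_format, of "(0, T)" \<epsilon>] T by force
  \<comment> \<open>The two halves of \<open>d0\<close> are spent on \<open>e\<close> and on the
    time; the other terms keep the times inside \<open>{a..b}\<close>.\<close>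
  define d where "d = min (d0 / 2) (min (T - a) (b - T))"
  have d: "d > 0" "d \<le> T - a" "d \<le> b - T" "d \<le> d0 / 2"
    using d0(1) T unfolding d_def by linarith+
  have sub: "ball T d \<subseteq> {a..b}" using d by (auto simp: dist_real_def)
  have Nc: "continuous_on {a..b} (N e)" for e
    by (rule continuous_on_compose2[OF N, of _ "\<lambda>t. (e, t)", simplified]) (auto intro!: continuous_intros)
  show "\<exists>d>0. \<forall>y. norm (y - (T, 0)) < d \<longrightarrow>
      norm ((case y of (s, e) \<Rightarrow> integral {a..s} (N e) - integral {a..T} (N e)) -
        (case (T, 0) of (s, e) \<Rightarrow> integral {a..s} (N e) - integral {a..T} (N e)) -
        (case y - (T, 0) of (ds, de) \<Rightarrow> ds * N 0 T)) \<le> \<epsilon> * norm (y - (T, 0))"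
  proof (intro exI[of _ d] conjI allI impI d(1))
    fix y :: "real \<times> 'e" assume y: "norm (y - (T, 0)) < d"
    obtain s e where se: "y = (s, e)" by (cases y)
    have n: "\<bar>s - T\<bar> \<le> norm (y - (T, 0))" "norm e \<le> norm (y - (T, 0))"
      using norm_fst_le[of "s - T" e] norm_snd_le[of e "s - T"] by (auto simp: se)
    \<comment> \<open>With the linear part subtracted, the derivative in \<open>s\<close> is at most
      \<epsilon> near \<open>T\<close>, and the mean value inequality gives the estimate.\<close>
    define G where "G s = integral {a..s} (N e) - s * N 0 T" for s
    have "norm (G s - G T) \<le> \<epsilon> * norm (s - T)"
    proof (rule field_differentiable_bound)
      show "convex (ball T d)" by simp
      show "(G has_field_derivative (N e z - N 0 T)) (at z within ball T d)" if "z \<in> ball T d" for z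
      proof -
        have "((\<lambda>x. integral {a..x} (N e)) has_real_derivative N e z) (at z within ball T d)"
          using that sub by (intro DERIV_subset[OF integral_has_real_derivative[OF Nc] sub]) auto
        then show ?thesis unfolding G_def by (auto intro!: derivative_eq_intros)
      qed
      show "norm (N e z - N 0 T) \<le> \<epsilon>" if "z \<in> ball T d" for z
      proof -
        have "dist (e, z) (0, T) \<le> norm e + \<bar>z - T\<bar>"
          using norm_Pair_le[of e "z - T"] by (simp add: dist_norm)
        also have "\<dots> < d0" using that d(4) n y by (simp add: dist_real_def abs_minus_commute)
        finally show ?thesis using d0(2)[of z e] that sub by (auto simp: dist_norm intro: less_imp_le)
      qed
      show "s \<in> ball T d" "T \<in> ball T d"
        using n y d(1) by (auto simp: dist_real_def abs_minus_commute)
    qed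
    also have "\<dots> \<le> \<epsilon> * norm (y - (T, 0))"
      using n \<open>0 < \<epsilon>\<close> by simp
    finally show "norm ((case y of (s, e) \<Rightarrow> integral {a..s} (N e) - integral {a..T} (N e)) -
        (case (T, 0) of (s, e) \<Rightarrow> integral {a..s} (N e) - integral {a..T} (N e)) -
        (case y - (T, 0) of (ds, de) \<Rightarrow> ds * N 0 T)) \<le> \<epsilon> * norm (y - (T, 0))"
      by (simp add: se G_def algebra_simps)
  qed
qed

section \<open>Integral functionals along affine perturbations\<close>

lemma functional_integrand_continuous:
  fixes A B :: "real \<Rightarrow> 'e::real_normed_vector \<Rightarrow>\<^sub>L real" and M :: "real \<times> real \<times> real \<Rightarrow> 'b::topological_space"
  assumes "continuous_on ({a..b} \<times> UNIV) M"
    and "continuous_on {a..b} X" "continuous_on {a..b} V" "continuous_on {a..b} A" "continuous_on {a..b} B"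
  shows "continuous_on (UNIV \<times> {a..b}) (\<lambda>(e, t). M (t, X t + A t e, V t + B t e))"
proof -
  have s: "continuous_on (UNIV \<times> {a..b}) (\<lambda>p. h (snd p))" if "continuous_on {a..b} h"
    for h :: "real \<Rightarrow> 'c::topological_space"
    by (rule continuous_on_compose2[OF that]) (auto intro!: continuous_intros)
  show ?thesis
    unfolding case_prod_unfold
    by (rule continuous_on_compose2[OF assms(1)]) (auto intro!: continuous_intros s assms)
qed

text \<open>The integral up to \<open>\<sigma> e\<close> splits into the integral up to
  \<open>T\<close>, differentiated under the integral sign, and the piece between \<open>T\<close>
  and \<open>\<sigma> e\<close>, covered by \<open>moving_endpoint_has_derivative\<close> and the
  chain rule.\<close>

lemma functional_has_derivative:
  fixes A B :: "real \<Rightarrow> 'e::banach \<Rightarrow>\<^sub>L real" and M :: "real \<times> real \<times> real \<Rightarrow> real"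
  assumes T: "a < T" "T < b"
    and M: "M differentiable_on {a..b} \<times> UNIV"
      "continuous_on ({a..b} \<times> UNIV) (pd2 M)" "continuous_on ({a..b} \<times> UNIV) (pd3 M)"
    and c: "continuous_on {a..b} X" "continuous_on {a..b} V" "continuous_on {a..b} A" "continuous_on {a..b} B"
    and \<sigma>: "(\<sigma> has_derivative \<sigma>') (at 0)" "\<sigma> 0 = T"
  shows "((\<lambda>e. integral {a..\<sigma> e} (\<lambda>t. M (t, X t + A t e, V t + B t e))) has_derivative
    (\<lambda>e. \<sigma>' e * M (T, X T, V T) +
      integral {a..T} (\<lambda>t. pd2 M (t, X t, V t) * A t e + pd3 M (t, X t, V t) * B t e))) (at 0)"
proof -
  define N where "N e t = M (t, X t + A t e, V t + B t e)" for e t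
  define P where "P e t = (t, X t + A t e, V t + B t e)" for e t
  \<comment> \<open>The derivative of \<open>N e t\<close> in the parameter \<open>e\<close>,
    written as a bounded linear functional as the Leibniz rule requires.\<close>
  define N' where "N' e t = pd2 M (P e t) *\<^sub>R A t + pd3 M (P e t) *\<^sub>R B t" for e t
  note cont = functional_integrand_continuous[OF _ c]
  have N: "continuous_on (UNIV \<times> {a..b}) (\<lambda>(e, t). N e t)"
    unfolding N_def by (rule cont[OF differentiable_imp_continuous_on[OF M(1)]])
  have Nc: "continuous_on {a..b} (N e)" for e
    by (rule continuous_on_compose2[OF N, of _ "\<lambda>t. (e, t)", simplified]) (auto intro!: continuous_intros)
  have sub: "{a..T} \<subseteq> {a..b}" using T by auto
  have AB: "continuous_on (UNIV \<times> {a..b}) (\<lambda>p. A (snd p))" "continuous_on (UNIV \<times> {a..b}) (\<lambda>p. B (snd p))"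
    by (rule continuous_on_compose2[OF c(3)] continuous_on_compose2[OF c(4)]; auto intro!: continuous_intros)+
  have N'c: "continuous_on (UNIV \<times> {a..b}) (\<lambda>(e, t). N' e t)"
    using cont[OF M(2)] cont[OF M(3)] AB unfolding N'_def P_def case_prod_unfold
    by (intro continuous_intros)
  have fixed: "((\<lambda>e. integral (cbox a T) (N e)) has_derivative integral (cbox a T) (N' 0)) (at 0 within UNIV)"
  proof (rule leibniz_rule)
    fix e t assume "t \<in> cbox a T"
    then have t: "t \<in> {a..b}" using sub by auto
    obtain D where "(M has_derivative D) (at (t, X t + A t e, V t + B t e) within {a..b} \<times> UNIV)"
      using M(1) t unfolding differentiable_on_def differentiable_def by blast
    note D = pd_eq(3)[OF this t]
    have "((\<lambda>e. (X t + A t e, V t + B t e)) has_derivative (\<lambda>d. (A t d, B t d))) (at e)"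
      by (auto intro!: derivative_eq_intros)
    from has_derivative_compose[OF this D]
    show "((\<lambda>e. N e t) has_derivative blinfun_apply (N' e t)) (at e within UNIV)"
      by (simp add: N_def N'_def P_def plus_blinfun.rep_eq scaleR_blinfun.rep_eq)
  next
    show "N e integrable_on cbox a T" for e
      using continuous_on_subset[OF Nc sub] by (simp add: integrable_continuous_interval)
    show "continuous_on (UNIV \<times> cbox a T) (\<lambda>(e, t). N' e t)"
      using sub by (intro continuous_on_subset[OF N'c]) auto
  qed auto
  have N'0: "N' 0 integrable_on {a..T}"
  proof (intro integrable_continuous_interval continuous_on_subset[OF _ sub])
    show "continuous_on {a..b} (N' 0)"
      by (rule continuous_on_compose2[OF N'c, of _ "\<lambda>t. (0, t)", simplified]) (auto intro!: continuous_intros)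
  qed
  have fixed': "integral {a..T} (N' 0) e =
      integral {a..T} (\<lambda>t. pd2 M (t, X t, V t) * A t e + pd3 M (t, X t, V t) * B t e)" for e
    unfolding blinfun_apply_integral[OF N'0]
    by (simp add: N'_def P_def blinfun.add_left blinfun.scaleR_left)
  have "((\<lambda>e. (\<sigma> e, e)) has_derivative (\<lambda>d. (\<sigma>' d, d))) (at 0)"
    using \<sigma>(1) by (auto intro!: derivative_eq_intros)
  from has_derivative_compose[OF this, unfolded \<sigma>(2), OF moving_endpoint_has_derivative[OF T N]]
  have "((\<lambda>e. integral {a..\<sigma> e} (N e) - integral {a..T} (N e)) has_derivative (\<lambda>d. \<sigma>' d * N 0 T)) (at 0)"
    by simp
  from has_derivative_add[OF this fixed[simplified]]
  show ?thesis
    by (simp add: fixed' N_def[abs_def])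
qed

section \<open>Fractional integrals\<close>

text \<open>The facts on weakly singular kernels, restricted to a subinterval. The freedom in
  \<open>c\<close> and \<open>d\<close> provides base points \<open>a\<close>, \<open>T\<close> and
  \<open>b\<close>; \<open>RL_swap\<close> is fractional integration by parts.\<close>

lemma
  assumes "weakly_singular a b (\<lambda>t s. (t - s) powr (- \<delta> t s) / Gamma (1 - \<delta> t s))"
    and f: "continuous_on {a..b} f" and c: "a \<le> c" "d \<le> b"
  shows RL_left_continuous: "continuous_on {c..d} (RL_int_left c \<delta> f)"
    and RL_right_continuous: "continuous_on {c..d} (RL_int_right d \<delta> f)"
    and RL_swap: "\<And>u. continuous_on {a..b} u \<Longrightarrow>
      integral {c..d} (\<lambda>t. u t * RL_int_left c \<delta> f t) = integral {c..d} (\<lambda>s. f s * RL_int_right d \<delta> u s)"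
    and RL_left_linear: "\<And>g t p q. continuous_on {a..b} g \<Longrightarrow> t \<in> {c..d} \<Longrightarrow>
      RL_int_left c \<delta> (\<lambda>s. p * f s + q * g s) t = p * RL_int_left c \<delta> f t + q * RL_int_left c \<delta> g t"
    and RL_right_linear: "\<And>g t p q. continuous_on {a..b} g \<Longrightarrow> t \<in> {c..d} \<Longrightarrow>
      RL_int_right d \<delta> (\<lambda>s. p * f s + q * g s) t = p * RL_int_right d \<delta> f t + q * RL_int_right d \<delta> g t"
proof -
  let ?w = "\<lambda>t s. (t - s) powr (- \<delta> t s) / Gamma (1 - \<delta> t s)"
  have w: "weakly_singular c d ?w" using weakly_singular_subset assms(1) c .
  have cont: "continuous_on {c..d} g" if "continuous_on {a..b} g" for g :: "real \<Rightarrow> real"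
    using c by (intro continuous_on_subset[OF that]) auto
  show "continuous_on {c..d} (RL_int_left c \<delta> f)" "continuous_on {c..d} (RL_int_right d \<delta> f)"
    using weakly_singular_continuous_left[OF w cont[OF f]] weakly_singular_continuous_right[OF w cont[OF f]]
    by (simp_all add: RL_int_left_def[abs_def] RL_int_right_def[abs_def])
  show "integral {c..d} (\<lambda>t. u t * RL_int_left c \<delta> f t) = integral {c..d} (\<lambda>s. f s * RL_int_right d \<delta> u s)"
    if "continuous_on {a..b} u" for u
    using weakly_singular_swap[OF w cont[OF f] cont[OF that]] by (simp add: RL_int_left_def RL_int_right_def)
  show "RL_int_left c \<delta> (\<lambda>s. p * f s + q * g s) t = p * RL_int_left c \<delta> f t + q * RL_int_left c \<delta> g t"
    if g: "continuous_on {a..b} g" and t: "t \<in> {c..d}" for g t p q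
  proof -
    have "integral {c..t} (\<lambda>s. p * (?w t s * f s) + q * (?w t s * g s)) =
        p * integral {c..t} (\<lambda>s. ?w t s * f s) + q * integral {c..t} (\<lambda>s. ?w t s * g s)"
      using weakly_singular_integrable_left[OF w cont[OF f] t] weakly_singular_integrable_left[OF w cont[OF g] t]
      by (simp only: Henstock_Kurzweil_Integration.integral_add integrable_on_mult_right integral_mult_right)
    moreover have "(\<lambda>s. ?w t s * (p * f s + q * g s)) = (\<lambda>s. p * (?w t s * f s) + q * (?w t s * g s))"
      by (intro ext) algebra
    ultimately show ?thesis unfolding RL_int_left_def by simp
  qed
  show "RL_int_right d \<delta> (\<lambda>s. p * f s + q * g s) t = p * RL_int_right d \<delta> f t + q * RL_int_right d \<delta> g t"
    if g: "continuous_on {a..b} g" and t: "t \<in> {c..d}" for g t p q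
  proof -
    have "integral {t..d} (\<lambda>s. p * (?w s t * f s) + q * (?w s t * g s)) =
        p * integral {t..d} (\<lambda>s. ?w s t * f s) + q * integral {t..d} (\<lambda>s. ?w s t * g s)"
      using weakly_singular_integrable_right[OF w cont[OF f] t] weakly_singular_integrable_right[OF w cont[OF g] t]
      by (simp only: Henstock_Kurzweil_Integration.integral_add integrable_on_mult_right integral_mult_right)
    moreover have "(\<lambda>s. ?w s t * (p * f s + q * g s)) = (\<lambda>s. p * (?w s t * f s) + q * (?w s t * g s))"
      by (intro ext) algebra
    ultimately show ?thesis unfolding RL_int_right_def by simp
  qed
qed

text \<open>In the second claim \<open>t\<close> is the base point and \<open>c\<close> the
  argument, so the same two bounds serve both claims.\<close>

lemma RL_int_cong:
  assumes "\<And>s. s \<in> {a..b} \<Longrightarrow> f s = g s" "a \<le> c" "t \<le> b"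
  shows "RL_int_left c \<delta> f t = RL_int_left c \<delta> g t"
    and "RL_int_right t \<delta> f c = RL_int_right t \<delta> g c"
  using assms by (auto simp: RL_int_left_def RL_int_right_def intro!: integral_cong)

text \<open>Testing with a nonnegative weight times \<open>W\<^sub>1\<close> before \<open>T\<close>
  and \<open>W\<^sub>2\<close> after it makes both integrals nonnegative, so each vanishes. The
  weight loses the values at \<open>T\<close>, which continuity restores.\<close>

lemma fundamental_lemma_two_intervals:
  fixes W\<^sub>1 W\<^sub>2 :: "real \<Rightarrow> real"
  assumes T: "a < T" "T < b"
    and W: "continuous_on {a..T} W\<^sub>1" "continuous_on {T..b} W\<^sub>2"
    and zero: "\<And>u. continuous_on {a..b} u \<Longrightarrow>
      integral {a..T} (\<lambda>t. u t * W\<^sub>1 t) + integral {T..b} (\<lambda>t. u t * W\<^sub>2 t) = 0"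
  shows "\<And>t. t \<in> {a..T} \<Longrightarrow> W\<^sub>1 t = 0" and "\<And>t. t \<in> {T..b} \<Longrightarrow> W\<^sub>2 t = 0"
proof -
  \<comment> \<open>The weight \<open>\<bar>t - T\<bar>\<close> makes the test function continuous at \<open>T\<close>.\<close>
  define u where "u t = (if t \<le> T then (T - t) * W\<^sub>1 t else (t - T) * W\<^sub>2 t)" for t
  have "continuous_on ({a..T} \<union> {T..b}) u"
    unfolding u_def by (intro continuous_on_If continuous_intros W) auto
  moreover have "{a..T} \<union> {T..b} = {a..b}" using T by auto
  ultimately have "integral {a..T} (\<lambda>t. u t * W\<^sub>1 t) + integral {T..b} (\<lambda>t. u t * W\<^sub>2 t) = 0"
    using zero by simp
  moreover have "integral {a..T} (\<lambda>t. u t * W\<^sub>1 t) = integral {a..T} (\<lambda>t. (T - t) * (W\<^sub>1 t)\<^sup>2)"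
    by (intro integral_cong) (auto simp: u_def power2_eq_square)
  moreover have "integral {T..b} (\<lambda>t. u t * W\<^sub>2 t) = integral {T..b} (\<lambda>t. (t - T) * (W\<^sub>2 t)\<^sup>2)"
    by (intro integral_cong) (auto simp: u_def power2_eq_square)
  moreover have "0 \<le> integral {a..T} (\<lambda>t. (T - t) * (W\<^sub>1 t)\<^sup>2)" "0 \<le> integral {T..b} (\<lambda>t. (t - T) * (W\<^sub>2 t)\<^sup>2)"
    by (auto intro!: Henstock_Kurzweil_Integration.integral_nonneg integrable_continuous_interval continuous_intros W)
  ultimately have "integral {a..T} (\<lambda>t. (T - t) * (W\<^sub>1 t)\<^sup>2) = 0" "integral {T..b} (\<lambda>t. (t - T) * (W\<^sub>2 t)\<^sup>2) = 0"
    by linarith+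
  then have "\<forall>t\<in>{a..T}. (T - t) * (W\<^sub>1 t)\<^sup>2 = 0" "\<forall>t\<in>{T..b}. (t - T) * (W\<^sub>2 t)\<^sup>2 = 0"
    using T integral_eq_0_iff[of a T "\<lambda>t. (T - t) * (W\<^sub>1 t)\<^sup>2"]
      integral_eq_0_iff[of T b "\<lambda>t. (t - T) * (W\<^sub>2 t)\<^sup>2"]
    by (simp_all add: continuous_intros W)
  then have z: "\<And>t. t \<in> {a..<T} \<Longrightarrow> W\<^sub>1 t = 0" "\<And>t. t \<in> {T<..b} \<Longrightarrow> W\<^sub>2 t = 0"
    by force+
  have cl: "closure {a..<T} = {a..T}" "closure {T<..b} = {T..b}"
    using T by (simp_all add: closure_atLeastLessThan closure_greaterThanAtMost)
  show "W\<^sub>1 t = 0" if "t \<in> {a..T}" for t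
    using continuous_constant_on_closure[of "{a..<T}" W\<^sub>1 0 t] W z that unfolding cl by blast
  show "W\<^sub>2 t = 0" if "t \<in> {T..b}" for t
    using continuous_constant_on_closure[of "{T<..b}" W\<^sub>2 0 t] W z that unfolding cl by blast
qed

text \<open>Integration by parts: the product of \<open>integral {a..t} u\<close> and
  \<open>integral {t..T} p\<close> vanishes at both ends.\<close>

lemma integral_mult_antiderivative:
  fixes p u :: "real \<Rightarrow> real"
  assumes "a \<le> T" "continuous_on {a..T} p" "continuous_on {a..T} u"
  shows "integral {a..T} (\<lambda>t. p t * integral {a..t} u) = integral {a..T} (\<lambda>t. u t * integral {t..T} p)"
proof -
  have 1: "((\<lambda>x. integral {a..x} u) has_real_derivative u t) (at t within {a..T})" if "t \<in> {a..T}" for t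
    using integral_has_real_derivative assms that by blast
  have 2: "((\<lambda>x. integral {x..T} p) has_real_derivative - p t) (at t within {a..T})" if "t \<in> {a..T}" for t
    using integral_has_real_derivative' assms that by blast
  have i: "(\<lambda>t. p t * integral {a..t} u) integrable_on {a..T}" "(\<lambda>t. u t * integral {t..T} p) integrable_on {a..T}"
    by (intro integrable_continuous_interval continuous_intros assms DERIV_continuous_on[OF 1]
        DERIV_continuous_on[OF 2]; assumption)+
  have "((\<lambda>t. u t * integral {t..T} p - p t * integral {a..t} u) has_integral
      (integral {a..T} u * integral {T..T} p - integral {a..a} u * integral {a..T} p)) {a..T}"
    using assms(1) 1 2
    by (intro fundamental_theorem_of_calculus)
      (auto intro!: derivative_eq_intros simp flip: has_real_derivative_iff_has_vector_derivative)
  from integral_unique[OF this] show ?thesis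
    using i by (simp add: Henstock_Kurzweil_Integration.integral_diff)
qed

section \<open>Functions of class C1 on an interval in terms of \<open>derivI\<close>\<close>

lemma C1_on_derivI:
  assumes "C1_on x {a..b}" "a < b"
  shows "\<And>t. t \<in> {a..b} \<Longrightarrow> (x has_real_derivative derivI a b x t) (at t within {a..b})"
    and "continuous_on {a..b} (derivI a b x)"
proof -
  obtain x' where c: "continuous_on {a..b} x'"
    and x': "\<And>t. t \<in> {a..b} \<Longrightarrow> (x has_derivative blinfun_apply (x' t)) (at t within {a..b})"
    using assms(1) unfolding C1_on_def by blast
  have "(x has_real_derivative x' t 1) (at t within {a..b})" if "t \<in> {a..b}" for t
  proof -
    have "blinfun_apply (x' t) = (*) (x' t 1)"
    proof
      show "x' t h = x' t 1 * h" for h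
        using blinfun.scaleR_right[of "x' t" h 1] by simp
    qed
    then show ?thesis using x'[OF that] by (simp add: has_field_derivative_def)
  qed
  moreover from this have d: "derivI a b x t = x' t 1" if "t \<in> {a..b}" for t
    unfolding derivI_def using that assms(2)
    by (intro vector_derivative_within_closed_interval)
      (auto simp flip: has_real_derivative_iff_has_vector_derivative)
  ultimately show "(x has_real_derivative derivI a b x t) (at t within {a..b})" if "t \<in> {a..b}" for t
    using that by simp
  have "continuous_on {a..b} (\<lambda>t. x' t 1)" using c by (intro continuous_intros)
  then show "continuous_on {a..b} (derivI a b x)" by (rule continuous_on_eq) (simp add: d)
qed

lemma C1_onI_real:
  assumes "a < b" "continuous_on {a..b} v"
    and x: "\<And>t. t \<in> {a..b} \<Longrightarrow> (x has_real_derivative v t) (at t within {a..b})"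
  shows "C1_on x {a..b}" and "\<And>t. t \<in> {a..b} \<Longrightarrow> derivI a b x t = v t"
proof -
  have "continuous_on {a..b} (\<lambda>t. blinfun_scaleR_left (v t))"
    using assms(2) by (rule bounded_linear.continuous_on[OF bounded_linear_blinfun_scaleR_left])
  then show "C1_on x {a..b}"
    unfolding C1_on_def using x
    by (intro exI[of _ "\<lambda>t. blinfun_scaleR_left (v t)"])
      (auto simp: has_real_derivative_iff_has_vector_derivative has_vector_derivative_eq_has_derivative_blinfun)
  show "derivI a b x t = v t" if "t \<in> {a..b}" for t
    unfolding derivI_def using that assms(1) x
    by (intro vector_derivative_within_closed_interval)
      (auto simp flip: has_real_derivative_iff_has_vector_derivative)
qed

section \<open>First variation\<close>

locale combined_orders =
  fixes a b \<gamma>\<^sub>1 \<gamma>\<^sub>2 :: real and \<alpha> \<beta> :: "real \<Rightarrow> real \<Rightarrow> real"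
  assumes ab: "a < b"
    and \<alpha>: "continuous_on ({a..b} \<times> {a..b}) (\<lambda>(t, \<tau>). \<alpha> t \<tau>)"
      "\<And>t \<tau>. t \<in> {a..b} \<Longrightarrow> \<tau> \<in> {a..b} \<Longrightarrow> \<alpha> t \<tau> \<in> {0<..<1}"
    and \<beta>: "continuous_on ({a..b} \<times> {a..b}) (\<lambda>(t, \<tau>). \<beta> t \<tau>)"
      "\<And>t \<tau>. t \<in> {a..b} \<Longrightarrow> \<tau> \<in> {a..b} \<Longrightarrow> \<beta> t \<tau> \<in> {0<..<1}"
begin

lemmas w\<alpha> = weakly_singular_RL_kernel[OF \<alpha>]
lemmas w\<beta> = weakly_singular_RL_kernel[OF \<beta>]

text \<open>The combined Caputo derivative as an operator on \<open>u = x'\<close> instead of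
  \<open>x\<close>. It is linear in \<open>u\<close>, and perturbations are parametrized by their
  derivatives.\<close>

definition \<D> :: "(real \<Rightarrow> real) \<Rightarrow> real \<Rightarrow> real" where
  "\<D> u t = \<gamma>\<^sub>1 * RL_int_left a \<alpha> u t + \<gamma>\<^sub>2 * - RL_int_right b \<beta> u t"

lemma comb_caputo_eq: "comb_caputo a b \<alpha> \<beta> \<gamma>\<^sub>1 \<gamma>\<^sub>2 x = \<D> (derivI a b x)"
  by (simp add: fun_eq_iff comb_caputo_def caputo_left_def caputo_right_def \<D>_def)

lemma \<D>_continuous: "continuous_on {a..b} u \<Longrightarrow> continuous_on {a..b} (\<D> u)"
  unfolding \<D>_def[abs_def]
  by (intro continuous_intros RL_left_continuous[OF w\<alpha>] RL_right_continuous[OF w\<beta>]) auto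

lemma \<D>_linear:
  assumes "continuous_on {a..b} u" "continuous_on {a..b} v" "t \<in> {a..b}"
  shows "\<D> (\<lambda>s. p * u s + q * v s) t = p * \<D> u t + q * \<D> v t"
  using RL_left_linear[OF w\<alpha> assms(1) order_refl order_refl assms(2,3), of p q]
    RL_right_linear[OF w\<beta> assms(1) order_refl order_refl assms(2,3), of p q]
  by (simp add: \<D>_def algebra_simps)

lemma \<D>_cong:
  assumes "\<And>s. s \<in> {a..b} \<Longrightarrow> u s = v s" "t \<in> {a..b}"
  shows "\<D> u t = \<D> v t"
  using RL_int_cong(1)[of a b u v a t \<alpha>] RL_int_cong(2)[of a b u v t b \<beta>] assms by (simp add: \<D>_def)

text \<open>The first variation of an integral functional with fixed end \<open>T\<close>, where
  \<open>p\<close> and \<open>f\<close> stand for the partial derivatives in the second and third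
  arguments. The direction is the antiderivative of \<open>u\<close> that vanishes at
  \<open>a\<close>.\<close>

definition variation :: "real \<Rightarrow> (real \<Rightarrow> real) \<Rightarrow> (real \<Rightarrow> real) \<Rightarrow> (real \<Rightarrow> real) \<Rightarrow> real" where
  "variation T p f u = integral {a..T} (\<lambda>t. p t * integral {a..t} u + f t * \<D> u t)"

text \<open>Formally, the derivative in \<open>t\<close> is minus the left side of the
  Euler--Lagrange equation on \<open>{a..T}\<close>. Working with this integrated form presupposes
  no differentiability of fractional integrals.\<close>

definition EL_residual :: "real \<Rightarrow> (real \<Rightarrow> real) \<Rightarrow> (real \<Rightarrow> real) \<Rightarrow> real \<Rightarrow> real" where
  "EL_residual T p f t = integral {t..T} p + \<gamma>\<^sub>1 * RL_int_right T \<alpha> f t - \<gamma>\<^sub>2 * RL_int_left a \<beta> f t"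

text \<open>The left Caputo term is integrated by parts on \<open>{a..T}\<close>. The right one sees
  \<open>u\<close> up to \<open>b\<close>, so its integral over \<open>{a..T}\<close> is written as
  that over \<open>{a..b}\<close> minus that over \<open>{T..b}\<close>, and each is integrated by
  parts. This is the source of the condition on \<open>{T..b}\<close>.\<close>

lemma variation_eq:
  assumes T: "a < T" "T < b"
    and c: "continuous_on {a..b} p" "continuous_on {a..b} f" "continuous_on {a..b} u"
  shows "variation T p f u = integral {a..T} (\<lambda>t. u t * EL_residual T p f t) +
    integral {T..b} (\<lambda>t. u t * (\<gamma>\<^sub>2 * (RL_int_left T \<beta> f t - RL_int_left a \<beta> f t)))"
proof -
  have sub: "{a..T} \<subseteq> {a..b}" "{T..b} \<subseteq> {a..b}" using T by auto
  have int: "g integrable_on {a..b}" "g integrable_on {a..T}" "g integrable_on {T..b}"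
    if "continuous_on {a..b} g" for g :: "real \<Rightarrow> real"
    using that sub continuous_on_subset by (blast intro: integrable_continuous_interval)+
  have cu: "continuous_on {a..b} (\<lambda>t. integral {a..t} u)"
    using c(3) by (intro indefinite_integral_continuous_1 int)
  have cont: "continuous_on {a..b} (RL_int_left a \<alpha> u)" "continuous_on {a..b} (RL_int_right b \<beta> u)"
    "continuous_on {a..b} (RL_int_left a \<beta> f)"
    using c by (auto intro: RL_left_continuous[OF w\<alpha>] RL_left_continuous[OF w\<beta>] RL_right_continuous[OF w\<beta>])
  have cont': "continuous_on {a..T} (RL_int_right T \<alpha> f)" "continuous_on {T..b} (RL_int_left T \<beta> f)"
    using c T by (auto intro: RL_left_continuous[OF w\<beta>] RL_right_continuous[OF w\<alpha>])
  have sa: "integral {a..T} (\<lambda>t. f t * RL_int_left a \<alpha> u t) = integral {a..T} (\<lambda>t. u t * RL_int_right T \<alpha> f t)"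
    using c T by (intro RL_swap[OF w\<alpha>]) auto
  have sb: "integral {a..b} (\<lambda>t. u t * RL_int_left a \<beta> f t) = integral {a..b} (\<lambda>t. f t * RL_int_right b \<beta> u t)"
    "integral {T..b} (\<lambda>t. u t * RL_int_left T \<beta> f t) = integral {T..b} (\<lambda>t. f t * RL_int_right b \<beta> u t)"
    using c T by (auto intro: RL_swap[OF w\<beta>])
  have s0: "integral {a..T} (\<lambda>t. p t * integral {a..t} u) = integral {a..T} (\<lambda>t. u t * integral {t..T} p)"
    using T c sub by (intro integral_mult_antiderivative) (auto intro: continuous_on_subset)
  have split: "integral {a..b} g = integral {a..T} g + integral {T..b} g"
    if "continuous_on {a..b} g" for g :: "real \<Rightarrow> real"
    using Henstock_Kurzweil_Integration.integral_combine[of a T b g] T int(1)[OF that] by simp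
  have "variation T p f u = integral {a..T} (\<lambda>t. p t * integral {a..t} u +
      (\<gamma>\<^sub>1 * (f t * RL_int_left a \<alpha> u t) - \<gamma>\<^sub>2 * (f t * RL_int_right b \<beta> u t)))"
    unfolding variation_def \<D>_def by (simp add: algebra_simps)
  also have "\<dots> = integral {a..T} (\<lambda>t. p t * integral {a..t} u) +
      (\<gamma>\<^sub>1 * integral {a..T} (\<lambda>t. f t * RL_int_left a \<alpha> u t) -
       \<gamma>\<^sub>2 * integral {a..T} (\<lambda>t. f t * RL_int_right b \<beta> u t))"
    by (simp add: Henstock_Kurzweil_Integration.integral_add Henstock_Kurzweil_Integration.integral_diff
        int integrable_diff integrable_on_mult_right continuous_on_mult c cu cont)
  \<comment> \<open>The two exchanges produce left integrals with base points \<open>a\<close> and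
    \<open>T\<close>; only their difference remains after \<open>T\<close>.\<close>
  also have "integral {a..T} (\<lambda>t. f t * RL_int_right b \<beta> u t) =
      integral {a..T} (\<lambda>t. u t * RL_int_left a \<beta> f t) +
      (integral {T..b} (\<lambda>t. u t * RL_int_left a \<beta> f t) - integral {T..b} (\<lambda>t. u t * RL_int_left T \<beta> f t))"
    using split[of "\<lambda>t. u t * RL_int_left a \<beta> f t"] split[of "\<lambda>t. f t * RL_int_right b \<beta> u t"] sb
    by (simp add: continuous_on_mult c cont)
  finally have v: "variation T p f u = integral {a..T} (\<lambda>t. u t * integral {t..T} p) +
      (\<gamma>\<^sub>1 * integral {a..T} (\<lambda>t. u t * RL_int_right T \<alpha> f t) -
       \<gamma>\<^sub>2 * integral {a..T} (\<lambda>t. u t * RL_int_left a \<beta> f t)) +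
      \<gamma>\<^sub>2 * (integral {T..b} (\<lambda>t. u t * RL_int_left T \<beta> f t) - integral {T..b} (\<lambda>t. u t * RL_int_left a \<beta> f t))"
    unfolding s0 sa by (simp add: algebra_simps)
  have cp: "continuous_on {a..T} (\<lambda>t. integral {t..T} p)"
    using c(1) sub by (intro indefinite_integral_continuous_1' int)
  have i: "(\<lambda>t. u t * integral {t..T} p) integrable_on {a..T}"
    "(\<lambda>t. u t * RL_int_right T \<alpha> f t) integrable_on {a..T}"
    "(\<lambda>t. u t * RL_int_left a \<beta> f t) integrable_on {a..T}"
    "(\<lambda>t. u t * RL_int_left a \<beta> f t) integrable_on {T..b}"
    "(\<lambda>t. u t * RL_int_left T \<beta> f t) integrable_on {T..b}"
    using c cont cont' cp sub
    by (auto intro!: integrable_continuous_interval continuous_on_mult intro: continuous_on_subset)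
  have "integral {a..T} (\<lambda>t. u t * EL_residual T p f t) = integral {a..T} (\<lambda>t. u t * integral {t..T} p +
      (\<gamma>\<^sub>1 * (u t * RL_int_right T \<alpha> f t) - \<gamma>\<^sub>2 * (u t * RL_int_left a \<beta> f t)))"
    unfolding EL_residual_def by (simp add: algebra_simps)
  also have "\<dots> = integral {a..T} (\<lambda>t. u t * integral {t..T} p) +
      (\<gamma>\<^sub>1 * integral {a..T} (\<lambda>t. u t * RL_int_right T \<alpha> f t) -
       \<gamma>\<^sub>2 * integral {a..T} (\<lambda>t. u t * RL_int_left a \<beta> f t))"
    using i by (simp add: Henstock_Kurzweil_Integration.integral_add Henstock_Kurzweil_Integration.integral_diff
        integrable_diff integrable_on_mult_right)
  finally have 1: "integral {a..T} (\<lambda>t. u t * EL_residual T p f t) = \<dots>" .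
  have "integral {T..b} (\<lambda>t. u t * (\<gamma>\<^sub>2 * (RL_int_left T \<beta> f t - RL_int_left a \<beta> f t))) =
      integral {T..b} (\<lambda>t. \<gamma>\<^sub>2 * (u t * RL_int_left T \<beta> f t - u t * RL_int_left a \<beta> f t))"
    by (simp add: algebra_simps)
  also have "\<dots> = \<gamma>\<^sub>2 * (integral {T..b} (\<lambda>t. u t * RL_int_left T \<beta> f t) - integral {T..b} (\<lambda>t. u t * RL_int_left a \<beta> f t))"
    using i by (simp add: Henstock_Kurzweil_Integration.integral_diff)
  finally show ?thesis unfolding v 1 by simp
qed

text \<open>The term with \<open>k\<close> is the contribution of an end point cost depending on the
  state at \<open>T\<close>. It adds the constant \<open>k\<close> to the weight of \<open>u\<close>
  on \<open>{a..T}\<close>, after which the fundamental lemma applies.\<close>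

lemma vanishing_variation:
  assumes T: "a < T" "T < b"
    and c: "continuous_on {a..b} p" "continuous_on {a..b} f"
    and zero: "\<And>u. continuous_on {a..b} u \<Longrightarrow> variation T p f u + k * integral {a..T} u = 0"
  shows "\<And>t. t \<in> {a..T} \<Longrightarrow> EL_residual T p f t + k = 0"
    and "\<And>t. t \<in> {T..b} \<Longrightarrow> \<gamma>\<^sub>2 * (RL_int_left T \<beta> f t - RL_int_left a \<beta> f t) = 0"
proof -
  have sub: "{a..T} \<subseteq> {a..b}" "{T..b} \<subseteq> {a..b}" using T by auto
  have cR: "continuous_on {a..T} (EL_residual T p f)"
    unfolding EL_residual_def[abs_def]
    using c T
    by (intro continuous_intros RL_right_continuous[OF w\<alpha>] RL_left_continuous[OF w\<beta>]
        indefinite_integral_continuous_1' integrable_continuous_interval continuous_on_subset[OF c(1) sub(1)]) auto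
  have 1: "continuous_on {a..T} (\<lambda>t. EL_residual T p f t + k)"
    by (intro continuous_intros cR)
  have "continuous_on {T..b} (RL_int_left a \<beta> f)" "continuous_on {T..b} (RL_int_left T \<beta> f)"
    using c T sub by (auto intro: RL_left_continuous[OF w\<beta>] continuous_on_subset[OF _ sub(2)])
  then have 2: "continuous_on {T..b} (\<lambda>t. \<gamma>\<^sub>2 * (RL_int_left T \<beta> f t - RL_int_left a \<beta> f t))"
    by (intro continuous_intros)
  have 3: "integral {a..T} (\<lambda>t. u t * (EL_residual T p f t + k)) +
      integral {T..b} (\<lambda>t. u t * (\<gamma>\<^sub>2 * (RL_int_left T \<beta> f t - RL_int_left a \<beta> f t))) = 0"
    if u: "continuous_on {a..b} u" for u
  proof -
    have "u integrable_on {a..T}" "(\<lambda>t. u t * EL_residual T p f t) integrable_on {a..T}"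
      using cR continuous_on_subset[OF u sub(1)] by (auto intro!: integrable_continuous_interval continuous_on_mult)
    then have "integral {a..T} (\<lambda>t. u t * (EL_residual T p f t + k)) =
        integral {a..T} (\<lambda>t. u t * EL_residual T p f t) + k * integral {a..T} u"
      by (simp add: distrib_left Henstock_Kurzweil_Integration.integral_add integrable_on_mult_right mult.commute[of _ k])
    then show ?thesis using zero[OF u] variation_eq[OF T c u] by simp
  qed
  show "EL_residual T p f t + k = 0" if "t \<in> {a..T}" for t
    using fundamental_lemma_two_intervals(1)[OF T 1 2 3 that] .
  show "\<gamma>\<^sub>2 * (RL_int_left T \<beta> f t - RL_int_left a \<beta> f t) = 0" if "t \<in> {T..b}" for t
    using fundamental_lemma_two_intervals(2)[OF T 1 2 3 that] .
qed

text \<open>The vanishing residual equates the combination of fractional integrals in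
  \<open>has_dual_deriv\<close> with \<open>integral {t..T}\<close> of a continuous function plus a
  constant. Hence the combination is differentiable on all of \<open>{a..T}\<close>, ends included.
  The last two claims are the end point values of the same identities.\<close>

lemma Euler_Lagrange_of_vanishing_variation:
  fixes F x
  defines "P \<equiv> bracket a b \<alpha> \<beta> \<gamma>\<^sub>1 \<gamma>\<^sub>2 x"
  assumes T: "a < T" "T < b"
    and c: "continuous_on {a..b} (\<lambda>s. pd2 F (P s))" "continuous_on {a..b} (\<lambda>s. pd3 F (P s))"
    and zero: "\<And>u. continuous_on {a..b} u \<Longrightarrow>
      variation T (\<lambda>s. pd2 F (P s)) (\<lambda>s. pd3 F (P s)) u + k * integral {a..T} u = 0"
  shows "EL_before a b \<alpha> \<beta> \<gamma>\<^sub>1 \<gamma>\<^sub>2 F x T" and "EL_after a b \<alpha> \<beta> \<gamma>\<^sub>1 \<gamma>\<^sub>2 F x T"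
    and "\<gamma>\<^sub>1 * RL_int_right T \<alpha> (\<lambda>s. pd3 F (P s)) T - \<gamma>\<^sub>2 * RL_int_left T \<beta> (\<lambda>s. pd3 F (P s)) T + k = 0"
    and "\<gamma>\<^sub>2 * (RL_int_left T \<beta> (\<lambda>s. pd3 F (P s)) b - RL_int_left a \<beta> (\<lambda>s. pd3 F (P s)) b) = 0"
proof -
  let ?p = "\<lambda>s. pd2 F (P s)" and ?f = "\<lambda>s. pd3 F (P s)"
  have before: "integral {t..T} ?p + k = \<gamma>\<^sub>2 * RL_int_left a \<beta> ?f t + \<gamma>\<^sub>1 * - RL_int_right T \<alpha> ?f t"
    if "t \<in> {a..T}" for t
    using vanishing_variation(1)[OF T c zero that] by (simp add: EL_residual_def)
  have after: "\<gamma>\<^sub>2 * (RL_int_left a \<beta> ?f t - RL_int_left T \<beta> ?f t) = 0" if "t \<in> {T..b}" for t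
    using vanishing_variation(2)[OF T c zero that] by auto
  have "continuous_on {a..T} ?p" using T by (intro continuous_on_subset[OF c(1)]) auto
  note deriv = integral_has_real_derivative'[OF this]
  show "EL_before a b \<alpha> \<beta> \<gamma>\<^sub>1 \<gamma>\<^sub>2 F x T"
    unfolding EL_before_def has_dual_deriv_def P_def[symmetric]
  proof (intro ballI exI conjI)
    fix t assume t: "t \<in> {a..T}"
    have "((\<lambda>t. integral {t..T} ?p + k) has_real_derivative - ?p t) (at t within {a..T})"
      using deriv[OF t] by (auto intro!: derivative_eq_intros)
    then show "((\<lambda>s. \<gamma>\<^sub>2 * RL_int_left a \<beta> ?f s + \<gamma>\<^sub>1 * - RL_int_right T \<alpha> ?f s)
        has_real_derivative - ?p t) (at t within {a..T})"
      by (rule has_field_derivative_transform_within[OF _ zero_less_one t]) (rule before)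
  qed simp
  show "EL_after a b \<alpha> \<beta> \<gamma>\<^sub>1 \<gamma>\<^sub>2 F x T"
    unfolding EL_after_def has_diff_deriv_def P_def[symmetric]
  proof
    fix t assume t: "t \<in> {T..b}"
    have "((\<lambda>s. 0) has_real_derivative 0) (at t within {T..b})" by simp
    then show "((\<lambda>s. \<gamma>\<^sub>2 * (RL_int_left a \<beta> ?f s - RL_int_left T \<beta> ?f s)) has_real_derivative 0)
        (at t within {T..b})"
      by (rule has_field_derivative_transform_within[OF _ zero_less_one t]) (simp only: after)
  qed
  \<comment> \<open>Both integrals are over the single point \<open>T\<close>, so this condition amounts to \<open>k = 0\<close>.\<close>
  have "RL_int_left T \<beta> ?f T = 0" "RL_int_right T \<alpha> ?f T = 0"
    by (simp_all add: RL_int_left_def RL_int_right_def)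
  then show "\<gamma>\<^sub>1 * RL_int_right T \<alpha> ?f T - \<gamma>\<^sub>2 * RL_int_left T \<beta> ?f T + k = 0"
    using before[of T] after[of T] T by simp
  show "\<gamma>\<^sub>2 * (RL_int_left T \<beta> ?f b - RL_int_left a \<beta> ?f b) = 0"
    using vanishing_variation(2)[OF T c zero, of b] T by simp
qed


section \<open>Two-parameter perturbations of the minimizer\<close>

lemma comb_caputo_antiderivative:
  assumes "continuous_on {a..b} v" "\<And>t. t \<in> {a..b} \<Longrightarrow> (z has_real_derivative v t) (at t within {a..b})"
    and t: "t \<in> {a..b}"
  shows "comb_caputo a b \<alpha> \<beta> \<gamma>\<^sub>1 \<gamma>\<^sub>2 z t = \<D> v t"
  unfolding comb_caputo_eq using C1_onI_real(2)[OF ab assms(1,2)] t by (rule \<D>_cong)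

text \<open>The plane multiplier rule is applied to cost and constraint along a two-parameter
  family: the first parameter moves \<open>x\<close> by the antiderivative of \<open>u\<close> and
  \<open>T\<close> by \<Delta>, the second moves \<open>x\<close> alone by the antiderivative of
  \<open>v\<close>. By \<open>v0\<close> the constraint has nonzero derivative in the second
  parameter.\<close>

lemma first_variations_proportional:
  fixes L g :: "real \<times> real \<times> real \<Rightarrow> real" and \<phi> :: "real \<times> real \<Rightarrow> real" and \<psi> x :: "real \<Rightarrow> real"
  defines "P \<equiv> bracket a b \<alpha> \<beta> \<gamma>\<^sub>1 \<gamma>\<^sub>2 x"
  assumes T: "a < T" "T < b"
    and L: "L differentiable_on {a..b} \<times> UNIV"
      "continuous_on ({a..b} \<times> UNIV) (pd2 L)" "continuous_on ({a..b} \<times> UNIV) (pd3 L)"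
    and g: "g differentiable_on {a..b} \<times> UNIV"
      "continuous_on ({a..b} \<times> UNIV) (pd2 g)" "continuous_on ({a..b} \<times> UNIV) (pd3 g)"
    and \<phi>: "\<phi> differentiable_on {a..b} \<times> UNIV"
    and \<psi>: "\<psi> differentiable_on {a..b}"
    and min: "local_minimum a b \<alpha> \<beta> \<gamma>\<^sub>1 \<gamma>\<^sub>2 (cost a b \<alpha> \<beta> \<gamma>\<^sub>1 \<gamma>\<^sub>2 L \<phi>)
      (admissible a b \<alpha> \<beta> \<gamma>\<^sub>1 \<gamma>\<^sub>2 g \<psi> x\<^sub>a) x T"
    and u: "continuous_on {a..b} u" and v: "continuous_on {a..b} v"
    and v0: "variation T (\<lambda>s. pd2 g (P s)) (\<lambda>s. pd3 g (P s)) v \<noteq> 0"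
  shows "(\<Delta> * L (P T) + variation T (\<lambda>s. pd2 L (P s)) (\<lambda>s. pd3 L (P s)) u +
      (pd1_phi a b \<phi> (T, x T) * \<Delta> + pd2_phi \<phi> (T, x T) * (derivI a b x T * \<Delta> + integral {a..T} u))) *
      variation T (\<lambda>s. pd2 g (P s)) (\<lambda>s. pd3 g (P s)) v =
    (\<Delta> * g (P T) + variation T (\<lambda>s. pd2 g (P s)) (\<lambda>s. pd3 g (P s)) u - derivI a b \<psi> T * \<Delta>) *
      (variation T (\<lambda>s. pd2 L (P s)) (\<lambda>s. pd3 L (P s)) v + pd2_phi \<phi> (T, x T) * integral {a..T} v)"
proof -
  have xD: "C1_on x {a..b}" and xa: "x a = x\<^sub>a" and con: "integral {a..T} (\<lambda>t. g (P t)) = \<psi> T"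
    using min by (auto simp: local_minimum_def admissible_def dom_D_def P_def)
  note x' = C1_on_derivI[OF xD ab]
  have xc: "continuous_on {a..b} x" using x'(1) by (rule DERIV_continuous_on)
  \<comment> \<open>Both antiderivatives vanish at \<open>a\<close>, so every perturbed function
    satisfies the boundary condition.\<close>
  define h k where "h t = integral {a..t} u" and "k t = integral {a..t} v" for t
  have h: "(h has_real_derivative u t) (at t within {a..b})" and k: "(k has_real_derivative v t) (at t within {a..b})"
    if "t \<in> {a..b}" for t
    unfolding h_def k_def using integral_has_real_derivative u v that by blast+
  have hc: "continuous_on {a..b} h" and kc: "continuous_on {a..b} k"
    using h k by (blast intro: DERIV_continuous_on)+
  define y where "y e t = x t + (fst e * h t + snd e * k t)" for e :: "real \<times> real" and t
  define y' where "y' e t = derivI a b x t + (fst e * u t + snd e * v t)" for e :: "real \<times> real" and t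
  \<comment> \<open>\<open>A t\<close> and \<open>B t\<close> are the changes of the state and of
    its combined derivative at time \<open>t\<close>, as linear functionals of the two
    parameters.\<close>
  define V A B where "V = \<D> (derivI a b x)"
    and "A t = h t *\<^sub>R fst_blinfun + k t *\<^sub>R (snd_blinfun :: (real \<times> real) \<Rightarrow>\<^sub>L real)"
    and "B t = \<D> u t *\<^sub>R fst_blinfun + \<D> v t *\<^sub>R (snd_blinfun :: (real \<times> real) \<Rightarrow>\<^sub>L real)" for t
  have A_apply: "A t e = fst e * h t + snd e * k t" and B_apply: "B t e = fst e * \<D> u t + snd e * \<D> v t" for t e
    by (simp_all add: A_def B_def blinfun.add_left blinfun.scaleR_left)
  have c: "continuous_on {a..b} x" "continuous_on {a..b} V" "continuous_on {a..b} A" "continuous_on {a..b} B"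
    unfolding A_def[abs_def] B_def[abs_def] V_def
    by (intro continuous_intros \<D>_continuous u v x' hc kc xc)+
  have P: "P t = (t, x t, V t)" for t
    by (simp add: P_def bracket_def comb_caputo_eq V_def)
  have duv: "continuous_on {a..b} (\<lambda>t. fst e * u t + snd e * v t)" for e :: "real \<times> real"
    by (intro continuous_intros u v)
  have y'c: "continuous_on {a..b} (y' e)" for e
    unfolding y'_def[abs_def] by (intro continuous_intros u v x')
  have y: "(y e has_real_derivative y' e t) (at t within {a..b})" if "t \<in> {a..b}" for e t
    unfolding y_def[abs_def] y'_def using h[OF that] k[OF that] x'(1)[OF that]
    by (auto intro!: derivative_eq_intros)
  have diff: "comb_caputo a b \<alpha> \<beta> \<gamma>\<^sub>1 \<gamma>\<^sub>2 (\<lambda>s. y e s - x s) t = B t e" if "t \<in> {a..b}" for e t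
  proof -
    have "comb_caputo a b \<alpha> \<beta> \<gamma>\<^sub>1 \<gamma>\<^sub>2 (\<lambda>s. y e s - x s) t = \<D> (\<lambda>t. fst e * u t + snd e * v t) t"
    proof (rule comb_caputo_antiderivative[OF duv _ that])
      show "((\<lambda>s. y e s - x s) has_real_derivative fst e * u t + snd e * v t) (at t within {a..b})"
        if "t \<in> {a..b}" for t
        using DERIV_diff[OF y[OF that] x'(1)[OF that]] by (simp add: y'_def)
    qed
    then show ?thesis using \<D>_linear[OF u v that] by (simp add: B_apply)
  qed
  have comb: "comb_caputo a b \<alpha> \<beta> \<gamma>\<^sub>1 \<gamma>\<^sub>2 (y e) t = V t + B t e" if "t \<in> {a..b}" for e t
  proof -
    have "comb_caputo a b \<alpha> \<beta> \<gamma>\<^sub>1 \<gamma>\<^sub>2 (y e) t = \<D> (y' e) t"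
      by (rule comb_caputo_antiderivative[OF y'c y that])
    also have "\<dots> = V t + \<D> (\<lambda>t. fst e * u t + snd e * v t) t"
      using \<D>_linear[OF x'(2) duv that, of 1 1] by (simp add: y'_def[abs_def] V_def)
    finally show ?thesis using \<D>_linear[OF u v that] by (simp add: B_apply)
  qed
  have br: "bracket a b \<alpha> \<beta> \<gamma>\<^sub>1 \<gamma>\<^sub>2 (y e) t = (t, x t + A t e, V t + B t e)" if "t \<in> {a..b}" for e t
    using comb[OF that] by (simp add: bracket_def y_def A_apply)
  have y0: "y 0 = x" by (simp add: y_def fun_eq_iff)

  define \<sigma> where "\<sigma> e = T + fst e * \<Delta>" for e :: "real \<times> real"
  have \<sigma>: "(\<sigma> has_derivative (\<lambda>e. fst e * \<Delta>)) (at 0)" "\<sigma> 0 = T"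
    by (auto simp: \<sigma>_def[abs_def] intro!: derivative_eq_intros)
  \<comment> \<open>Parameters whose end time stays inside the interval; there the formula
    \<open>br\<close> may be used under the integral.\<close>
  define U where "U = {e. a < \<sigma> e \<and> \<sigma> e < b}"
  have U: "open U" "0 \<in> U"
    using T unfolding U_def \<sigma>_def by (auto intro!: open_Collect_conj open_Collect_less continuous_intros)
  have int_eq: "integral {a..\<sigma> e} (\<lambda>t. M (bracket a b \<alpha> \<beta> \<gamma>\<^sub>1 \<gamma>\<^sub>2 (y e) t)) =
      integral {a..\<sigma> e} (\<lambda>t. M (t, x t + A t e, V t + B t e))"
    if "e \<in> U" for e and M :: "real \<times> real \<times> real \<Rightarrow> real"
    using that by (intro integral_cong) (simp add: br U_def)
  have functional: "((\<lambda>e. integral {a..\<sigma> e} (\<lambda>t. M (bracket a b \<alpha> \<beta> \<gamma>\<^sub>1 \<gamma>\<^sub>2 (y e) t))) has_derivative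
      (\<lambda>e. fst e * \<Delta> * M (P T) + integral {a..T} (\<lambda>t. pd2 M (P t) * A t e + pd3 M (P t) * B t e))) (at 0)"
    if "M differentiable_on {a..b} \<times> UNIV" "continuous_on ({a..b} \<times> UNIV) (pd2 M)"
      "continuous_on ({a..b} \<times> UNIV) (pd3 M)" for M
    using functional_has_derivative[OF T that c \<sigma>] unfolding P
    by (rule has_derivative_transform_within_open[OF _ U]) (simp add: int_eq)
  have Tab: "T \<in> {a..b}" and atT: "at T within {a..b} = at T"
    using T by (auto simp: at_within_Icc_at)
  have comp: "((\<lambda>e. f (\<sigma> e)) has_derivative (\<lambda>e. d * (fst e * \<Delta>))) (at 0)"
    if "(f has_real_derivative d) (at T within {a..b})" for f d
    using has_derivative_compose[OF \<sigma>(1), of f "(*) d"] that \<sigma>(2) by (simp add: atT has_field_derivative_def)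
  have \<psi>': "(\<psi> has_real_derivative derivI a b \<psi> T) (at T within {a..b})"
    using \<psi> Tab unfolding derivI_def differentiable_on_def
    by (simp add: has_real_derivative_iff_has_vector_derivative vector_derivative_works)
  \<comment> \<open>The state is evaluated at the moving end time. At \<open>e = 0\<close> this adds
    the velocity of \<open>x\<close> at \<open>T\<close>, while the derivatives of \<open>h\<close>
    and \<open>k\<close> drop out because their coefficients vanish.\<close>
  have "((\<lambda>e. (\<sigma> e, y e (\<sigma> e))) has_derivative
      (\<lambda>e. (fst e * \<Delta>, derivI a b x T * (fst e * \<Delta>) + (fst e * h T + snd e * k T)))) (at 0)"
    unfolding y_def
    using comp[OF x'(1)[OF Tab]] comp[OF h[OF Tab]] comp[OF k[OF Tab]] \<sigma>
    by (auto intro!: derivative_eq_intros)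
  moreover obtain \<phi>' where "(\<phi> has_derivative \<phi>') (at (T, x T) within {a..b} \<times> UNIV)"
    using \<phi> Tab unfolding differentiable_on_def differentiable_def by blast
  from pd_phi_eq[OF this] T
  have "(\<phi> has_derivative (\<lambda>(h, k). pd1_phi a b \<phi> (T, x T) * h + pd2_phi \<phi> (T, x T) * k)) (at (\<sigma> 0, y 0 (\<sigma> 0)))"
    by (simp add: \<sigma>(2) y0)
  ultimately have \<phi>D: "((\<lambda>e. \<phi> (\<sigma> e, y e (\<sigma> e))) has_derivative
      (\<lambda>e. pd1_phi a b \<phi> (T, x T) * (fst e * \<Delta>) +
        pd2_phi \<phi> (T, x T) * (derivI a b x T * (fst e * \<Delta>) + (fst e * h T + snd e * k T)))) (at 0)"
    using has_derivative_compose[of "\<lambda>e. (\<sigma> e, y e (\<sigma> e))" _ 0 UNIV \<phi>] by fastforce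
  define J where "J e = cost a b \<alpha> \<beta> \<gamma>\<^sub>1 \<gamma>\<^sub>2 L \<phi> (y e) (\<sigma> e)" for e
  define K where "K e = integral {a..\<sigma> e} (\<lambda>t. g (bracket a b \<alpha> \<beta> \<gamma>\<^sub>1 \<gamma>\<^sub>2 (y e) t)) - \<psi> (\<sigma> e)" for e
  note J' = has_derivative_add[OF functional[OF L] \<phi>D, folded cost_def J_def]
  note K' = has_derivative_diff[OF functional[OF g] comp[OF \<psi>'], folded K_def]
  \<comment> \<open>On the two basis directions the derivatives of cost and constraint turn into
    variations in \<open>u\<close> and \<open>v\<close>.\<close>
  have A01: "A t (0, 1) = integral {a..t} v" "A t (1, 0) = integral {a..t} u"
    "B t (0, 1) = \<D> v t" "B t (1, 0) = \<D> u t" for t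
    by (simp_all add: A_apply B_apply h_def k_def)
  note rule = multiplier_rule_plane[OF J' K']
  show ?thesis
  proof (rule rule[unfolded A01 fst_conv snd_conv, folded variation_def,
        unfolded h_def k_def, simplified])
    show "K 0 = 0"
      by (simp add: K_def y0 \<sigma>(2) con flip: P_def)
    show "variation T (\<lambda>s. pd2 g (P s)) (\<lambda>s. pd3 g (P s)) v \<noteq> 0" by (rule v0)
    \<comment> \<open>With the first parameter fixed, the end time and the value of \<psi> are
      constant, so only an integral over a fixed interval depends on \<open>r\<close>.\<close>
    show "\<forall>\<^sub>F e in at 0. continuous_on UNIV (\<lambda>r. K (e, r))"
    proof -
      have "open {e. (e, 0) \<in> U}" "0 \<in> {e. (e, 0) \<in> U}"
        using U(2) unfolding U_def \<sigma>_def
        by (auto intro!: open_Collect_conj open_Collect_less continuous_intros simp: zero_prod_def)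
      then have "\<forall>\<^sub>F e in at 0. (e, 0) \<in> U"
        by (auto simp: eventually_at_topological)
      then show ?thesis
      proof eventually_elim
        case (elim e)
        define S where "S = T + e * \<Delta>"
        have S: "\<sigma> (e, r) = S" "(e, r) \<in> U" for r using elim by (auto simp: \<sigma>_def U_def S_def)
        have "continuous_on (UNIV \<times> {a..S}) (\<lambda>q. case ((e, fst q), snd q) of (e, t) \<Rightarrow> g (t, x t + A t e, V t + B t e))"
          using S[of 0]
          by (intro continuous_on_compose2[OF functional_integrand_continuous[OF differentiable_imp_continuous_on[OF g(1)] c]]
              continuous_intros) (auto simp: U_def)
        then have "continuous_on UNIV (\<lambda>r. integral (cbox a S) (\<lambda>t. g (t, x t + A t (e, r), V t + B t (e, r))))"
          by (intro integral_continuous_on_param) (simp add: case_prod_unfold)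
        then show ?case
          using int_eq[where M = g, OF S(2)] by (simp add: K_def S(1) continuous_on_diff)
      qed
    qed
    show "\<forall>\<^sub>F p in nhds 0. K p = 0 \<longrightarrow> J 0 \<le> J p"
    proof -
      obtain \<epsilon> where \<epsilon>: "\<epsilon> > 0" "\<And>z S. (z, S) \<in> admissible a b \<alpha> \<beta> \<gamma>\<^sub>1 \<gamma>\<^sub>2 g \<psi> x\<^sub>a \<Longrightarrow>
          norm_D a b \<alpha> \<beta> \<gamma>\<^sub>1 \<gamma>\<^sub>2 (\<lambda>s. z s - x s) (S - T) < \<epsilon> \<Longrightarrow>
          cost a b \<alpha> \<beta> \<gamma>\<^sub>1 \<gamma>\<^sub>2 L \<phi> x T \<le> cost a b \<alpha> \<beta> \<gamma>\<^sub>1 \<gamma>\<^sub>2 L \<phi> z S"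
        using min unfolding local_minimum_def by blast
      have bounded: "\<exists>B. \<forall>t\<in>{a..b}. \<bar>f t\<bar> \<le> B" if "continuous_on {a..b} f" for f :: "real \<Rightarrow> real"
        using compact_imp_bounded[OF compact_continuous_image[OF that compact_Icc]]
        by (auto simp: bounded_iff)
      obtain H1 H2 D1 D2 where bd: "\<And>t. t \<in> {a..b} \<Longrightarrow> \<bar>h t\<bar> \<le> H1" "\<And>t. t \<in> {a..b} \<Longrightarrow> \<bar>k t\<bar> \<le> H2"
          "\<And>t. t \<in> {a..b} \<Longrightarrow> \<bar>\<D> u t\<bar> \<le> D1" "\<And>t. t \<in> {a..b} \<Longrightarrow> \<bar>\<D> v t\<bar> \<le> D2"
        using bounded[OF hc] bounded[OF kc] bounded[OF \<D>_continuous[OF u]] bounded[OF \<D>_continuous[OF v]]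
        by blast
      \<comment> \<open>A continuous majorant, zero at the origin, for the norm of the perturbation;
        small parameters therefore stay within the range of the local minimum.\<close>
      define N where "N e = (\<bar>fst e\<bar> * H1 + \<bar>snd e\<bar> * H2) + (\<bar>fst e\<bar> * D1 + \<bar>snd e\<bar> * D2) + \<bar>fst e * \<Delta>\<bar>" for e
      have lin: "\<bar>p * c + q * d\<bar> \<le> \<bar>p\<bar> * C + \<bar>q\<bar> * D" if "\<bar>c\<bar> \<le> C" "\<bar>d\<bar> \<le> D" for p q c d C D :: real
      proof -
        have "\<bar>p * c + q * d\<bar> \<le> \<bar>p\<bar> * \<bar>c\<bar> + \<bar>q\<bar> * \<bar>d\<bar>"
          by (metis abs_mult abs_triangle_ineq)
        also have "\<dots> \<le> \<bar>p\<bar> * C + \<bar>q\<bar> * D"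
          using that by (intro add_mono mult_left_mono) auto
        finally show ?thesis .
      qed
      have normD: "norm_D a b \<alpha> \<beta> \<gamma>\<^sub>1 \<gamma>\<^sub>2 (\<lambda>s. y e s - x s) (\<sigma> e - T) \<le> N e" for e
        unfolding norm_D_def N_def
      proof (intro add_mono cSUP_least)
        show "\<bar>y e s - x s\<bar> \<le> \<bar>fst e\<bar> * H1 + \<bar>snd e\<bar> * H2" if "s \<in> {a..b}" for s
          using bd(1,2)[OF that] by (simp add: y_def lin)
        show "\<bar>comb_caputo a b \<alpha> \<beta> \<gamma>\<^sub>1 \<gamma>\<^sub>2 (\<lambda>s. y e s - x s) s\<bar> \<le> \<bar>fst e\<bar> * D1 + \<bar>snd e\<bar> * D2"
          if "s \<in> {a..b}" for s
          using bd(3,4)[OF that] by (simp add: diff[OF that] B_apply lin)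
      qed (use ab in \<open>auto simp: \<sigma>_def\<close>)
      have "open {e. N e < \<epsilon>}"
        unfolding N_def by (intro open_Collect_less continuous_intros)
      moreover have "0 \<in> {e. N e < \<epsilon>}" using \<epsilon>(1) by (simp add: N_def)
      ultimately have "\<forall>\<^sub>F e in nhds 0. e \<in> {e. N e < \<epsilon>} \<and> e \<in> U"
        using U by (intro eventually_conj eventually_nhds_in_open)
      then show ?thesis
      proof eventually_elim
        case (elim e)
        have "(y e, \<sigma> e) \<in> admissible a b \<alpha> \<beta> \<gamma>\<^sub>1 \<gamma>\<^sub>2 g \<psi> x\<^sub>a" if "K e = 0"
        proof -
          have "continuous_on {a..b} (\<lambda>t. V t + B t e)"
            by (intro continuous_intros c)
          then have "continuous_on {a..b} (comb_caputo a b \<alpha> \<beta> \<gamma>\<^sub>1 \<gamma>\<^sub>2 (y e))"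
            by (rule continuous_on_eq) (simp add: comb)
          moreover have "C1_on (y e) {a..b}" by (rule C1_onI_real[OF ab y'c y])
          moreover have "y e a = x\<^sub>a" by (simp add: y_def h_def k_def xa)
          ultimately show ?thesis
            using that elim by (simp add: admissible_def dom_D_def K_def U_def)
        qed
        then show ?case
          using \<epsilon>(2)[of "y e" "\<sigma> e"] normD[of e] elim by (auto simp: J_def y0 \<sigma>(2))
      qed
    qed
  qed
qed

end

section \<open>Choice of the multiplier and derivation of the necessary conditions\<close>

theorem theorem51:
  fixes a b x\<^sub>a \<gamma>\<^sub>1 \<gamma>\<^sub>2 T :: real
    and \<alpha> \<beta> :: "real \<Rightarrow> real \<Rightarrow> real"
    and L g :: "real \<times> real \<times> real \<Rightarrow> real"
    and \<phi> :: "real \<times> real \<Rightarrow> real"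
    and \<psi> x :: "real \<Rightarrow> real"
  assumes "a < b"
    and "continuous_on ({a..b} \<times> {a..b}) (\<lambda>(t, \<tau>). \<alpha> t \<tau>)"
    and "\<And>t \<tau>. t \<in> {a..b} \<Longrightarrow> \<tau> \<in> {a..b} \<Longrightarrow> \<alpha> t \<tau> \<in> {0<..<1}"
    and "continuous_on ({a..b} \<times> {a..b}) (\<lambda>(t, \<tau>). \<beta> t \<tau>)"
    and "\<And>t \<tau>. t \<in> {a..b} \<Longrightarrow> \<tau> \<in> {a..b} \<Longrightarrow> \<beta> t \<tau> \<in> {0<..<1}"
    and "\<gamma>\<^sub>1 \<in> {0..1}" "\<gamma>\<^sub>2 \<in> {0..1}" "\<not> (\<gamma>\<^sub>1 = 0 \<and> \<gamma>\<^sub>2 = 0)"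
    and "L differentiable_on ({a..b} \<times> UNIV)"
    and "continuous_on ({a..b} \<times> UNIV) (pd2 L)" "continuous_on ({a..b} \<times> UNIV) (pd3 L)"
    and "C1_on \<phi> ({a..b} \<times> UNIV)"
    and "C1_on g ({a..b} \<times> UNIV)"
    and "\<psi> differentiable_on {a..b}"
    and "a < T" "T < b"
    and "local_minimum a b \<alpha> \<beta> \<gamma>\<^sub>1 \<gamma>\<^sub>2 (cost a b \<alpha> \<beta> \<gamma>\<^sub>1 \<gamma>\<^sub>2 L \<phi>)
           (admissible a b \<alpha> \<beta> \<gamma>\<^sub>1 \<gamma>\<^sub>2 g \<psi> x\<^sub>a) x T"
    and "\<not> EL_before a b \<alpha> \<beta> \<gamma>\<^sub>1 \<gamma>\<^sub>2 g x T \<or> \<not> EL_after a b \<alpha> \<beta> \<gamma>\<^sub>1 \<gamma>\<^sub>2 g x T"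
  shows "\<exists>lam::real.
    let F = (\<lambda>p. L p - lam * g p);
        f = (\<lambda>s. pd3 F (bracket a b \<alpha> \<beta> \<gamma>\<^sub>1 \<gamma>\<^sub>2 x s))
    in EL_before a b \<alpha> \<beta> \<gamma>\<^sub>1 \<gamma>\<^sub>2 F x T \<and>
       EL_after a b \<alpha> \<beta> \<gamma>\<^sub>1 \<gamma>\<^sub>2 F x T \<and>
       F (bracket a b \<alpha> \<beta> \<gamma>\<^sub>1 \<gamma>\<^sub>2 x T) + pd1_phi a b \<phi> (T, x T)
         + pd2_phi \<phi> (T, x T) * derivI a b x T + lam * derivI a b \<psi> T = 0 \<and>
       \<gamma>\<^sub>1 * RL_int_right T \<alpha> f T - \<gamma>\<^sub>2 * RL_int_left T \<beta> f T + pd2_phi \<phi> (T, x T) = 0 \<and>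
       \<gamma>\<^sub>2 * (RL_int_left T \<beta> f b - RL_int_left a \<beta> f b) = 0"
proof -
  interpret combined_orders a b \<gamma>\<^sub>1 \<gamma>\<^sub>2 \<alpha> \<beta>
    using assms(1-5) by unfold_locales
  note T = assms(15,16) and L = assms(9-11) and g = C1_on_imp_continuous_pd[OF assms(13)] and min = assms(17)
  let ?P = "bracket a b \<alpha> \<beta> \<gamma>\<^sub>1 \<gamma>\<^sub>2 x"
  let ?p = "\<lambda>M s. pd2 M (?P s)" and ?f = "\<lambda>M s. pd3 M (?P s)"
  have \<phi>: "\<phi> differentiable_on {a..b} \<times> UNIV"
    using assms(12) unfolding C1_on_def differentiable_on_def differentiable_def by blast
  have "C1_on x {a..b}" and Vc: "continuous_on {a..b} (comb_caputo a b \<alpha> \<beta> \<gamma>\<^sub>1 \<gamma>\<^sub>2 x)"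
    using min by (auto simp: local_minimum_def admissible_def dom_D_def)
  then have "continuous_on {a..b} x"
    using C1_on_derivI(1)[OF _ ab] by (blast intro: DERIV_continuous_on)
  with Vc have Pc: "continuous_on {a..b} ?P" and Pin: "\<And>t. t \<in> {a..b} \<Longrightarrow> ?P t \<in> {a..b} \<times> UNIV"
    by (auto simp: bracket_def[abs_def] intro!: continuous_intros)
  have cP: "continuous_on {a..b} (\<lambda>s. h (?P s))" if "continuous_on ({a..b} \<times> UNIV) h" for h :: "real \<times> real \<times> real \<Rightarrow> real"
    using Pin by (intro continuous_on_compose2[OF that Pc]) blast
  \<comment> \<open>If the variation of the constraint vanished identically, the case
    \<open>k = 0\<close> of \<open>Euler_Lagrange_of_vanishing_variation\<close> would give both
    Euler--Lagrange equations for \<open>g\<close>.\<close>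
  have "\<exists>v. continuous_on {a..b} v \<and> variation T (?p g) (?f g) v \<noteq> 0"
  proof (rule ccontr)
    assume "\<not> ?thesis"
    then have "variation T (?p g) (?f g) u + 0 * integral {a..T} u = 0" if "continuous_on {a..b} u" for u
      using that by auto
    then show False
      using Euler_Lagrange_of_vanishing_variation(1,2)[OF T cP[OF g(2)] cP[OF g(3)], of 0] assms(18) by blast
  qed
  then obtain v where v: "continuous_on {a..b} v" "variation T (?p g) (?f g) v \<noteq> 0"
    by blast
  \<comment> \<open>The ratio of the derivatives of cost and constraint in the direction
    \<open>v\<close>. By proportionality it serves every other direction \<open>u\<close> and every
    \<Delta>.\<close>
  define lam where "lam = (variation T (?p L) (?f L) v + pd2_phi \<phi> (T, x T) * integral {a..T} v) /
    variation T (?p g) (?f g) v"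
  have multiplier: "\<Delta> * L (?P T) + variation T (?p L) (?f L) u +
      (pd1_phi a b \<phi> (T, x T) * \<Delta> + pd2_phi \<phi> (T, x T) * (derivI a b x T * \<Delta> + integral {a..T} u)) =
    lam * (\<Delta> * g (?P T) + variation T (?p g) (?f g) u - derivI a b \<psi> T * \<Delta>)"
    if "continuous_on {a..b} u" for u \<Delta>
    using first_variations_proportional[OF T L g \<phi> assms(14) min that v, of \<Delta>] v(2)
    by (simp add: lam_def field_simps)
  define F where "F = (\<lambda>p. L p - lam * g p)"
  have FP: "?p F t = ?p L t - lam * ?p g t" "?f F t = ?f L t - lam * ?f g t" if "t \<in> {a..b}" for t
    unfolding F_def using pd_diff_cmult[OF L(1) g(1) Pin[OF that]] by auto
  have Fc: "continuous_on {a..b} (?p F)" "continuous_on {a..b} (?f F)"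
  proof -
    have "continuous_on {a..b} (\<lambda>t. ?p L t - lam * ?p g t)" "continuous_on {a..b} (\<lambda>t. ?f L t - lam * ?f g t)"
      by (intro continuous_intros cP L g)+
    then show "continuous_on {a..b} (?p F)" "continuous_on {a..b} (?f F)"
      by (auto intro: continuous_on_eq simp: FP)
  qed
  \<comment> \<open>Keeping the end time fixed, \<Delta> = 0, removes \<psi> and the time derivative
    of \<phi>. What remains is the hypothesis of
    \<open>Euler_Lagrange_of_vanishing_variation\<close> with
    \<open>k = pd2_phi \<phi> (T, x T)\<close>.\<close>
  have var_F: "variation T (?p F) (?f F) u + pd2_phi \<phi> (T, x T) * integral {a..T} u = 0"
    if u: "continuous_on {a..b} u" for u
  proof -
    have sub: "{a..T} \<subseteq> {a..b}" using T by auto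
    have "(\<lambda>t. integral {a..t} u) integrable_on {a..T}" "continuous_on {a..b} (\<lambda>t. integral {a..t} u)"
      using u T by (auto intro!: integrable_continuous_interval indefinite_integral_continuous_1 intro: continuous_on_subset)
    then have i: "(\<lambda>t. ?p M t * integral {a..t} u + ?f M t * \<D> u t) integrable_on {a..T}"
      if "continuous_on ({a..b} \<times> UNIV) (pd2 M)" "continuous_on ({a..b} \<times> UNIV) (pd3 M)" for M
      using u that
      by (intro integrable_continuous_interval continuous_on_subset[OF _ sub] continuous_intros cP \<D>_continuous)
    have "variation T (?p F) (?f F) u = integral {a..T} (\<lambda>t. (?p L t * integral {a..t} u + ?f L t * \<D> u t) -
        lam * (?p g t * integral {a..t} u + ?f g t * \<D> u t))"
      unfolding variation_def using T by (intro integral_cong) (simp add: FP algebra_simps)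
    also have "\<dots> = variation T (?p L) (?f L) u - lam * variation T (?p g) (?f g) u"
      unfolding variation_def
      using i[OF L(2,3)] i[OF g(2,3)]
      by (simp add: Henstock_Kurzweil_Integration.integral_diff integrable_on_mult_right)
    finally show ?thesis
      using multiplier[OF u, of 0] by simp
  qed
  \<comment> \<open>Moving only the end time, \<open>u = 0\<close> and \<Delta> = 1, leaves the
    first transversality condition.\<close>
  have "variation T p f (\<lambda>_. 0) = 0" for p f
    by (simp add: variation_def \<D>_def RL_int_left_def RL_int_right_def)
  then have "F (?P T) + pd1_phi a b \<phi> (T, x T) + pd2_phi \<phi> (T, x T) * derivI a b x T + lam * derivI a b \<psi> T = 0"
    using multiplier[of "\<lambda>_. 0" 1] by (simp add: F_def algebra_simps)
  with Euler_Lagrange_of_vanishing_variation[OF T Fc var_F] show ?thesis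
    unfolding F_def Let_def by blast
qed

end
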